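(* Let $X(\mathbb{R}^n)$ be a Banach function space and $X'(\mathbb{R}^n)$ its associate space. If $a\in\mathcal{M}^0_{X(\mathbb{R}^n)}\cap\mathcal{M}^0_{X'(\mathbb{R}^n)}$, then \[ \|a\|_{L^\infty(\mathbb{R}^n)}\le\|a\|^{1/2}_{\mathcal{M}^0_{X(\mathbb{R}^n)}}\|a\|^{1/2}_{\mathcal{M}^0_{X'(\mathbb{R}^n)}}. \]
   Context: Banach function spaces: let $\mathfrak{M}^+(\mathbb{R}^n)$ be the set of measurable functions with values in $[0,\infty]$. A Banach function norm $\rho:\mathfrak{M}^+\to[0,\infty]$ satisfies, for all $f,g,f_j\in\mathfrak{M}^+$, $a\ge0$, measurable $E$: (A1) $\rho(f)=0\iff f=0$ a.e., $\rho(af)=a\rho(f)$, $\rho(f+g)\le\rho(f)+\rho(g)$; (A2) $0\le g\le f$ a.e. implies $\rho(g)\le\rho(f)$; (A3) $0\le f_j\uparrow f$ a.e. implies $\rho(f_j)\uparrow\rho(f)$; (A4) $|E|<\infty$ implies $\rho(\chi_E)<\infty$; (A5) $|E|<\infty$ implies $\int_Ef\le C_E\rho(f)$ with $C_E$ independent of $f$. $X(\mathbb{R}^n)$ is the set of measurable complex $f$ with $\rho(|f|)<\infty$, $\|f\|_X=\rho(|f|)$. The associate norm is $\rho'(g)=\sup\{\int fg\,dx: f\in\mathfrak{M}^+,\ \rho(f)\le1\}$, itself a Banach function norm; $X'(\mathbb{R}^n)$ is the Banach function space it determines. Fourier transform: $(Fu)(\xi)=\int u(x)e^{-ix\xi}dx$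 on $L^2(\mathbb{R}^n)$. For a normed function space $Z$, $\mathcal{M}^0_{Z}$ is the set of $a\in L^\infty(\mathbb{R}^n)$ with $\|a\|_{\mathcal{M}^0_Z}:=\sup\{\|F^{-1}aFu\|_{Z}/\|u\|_{Z}: u\in (L^2(\mathbb{R}^n)\cap Z)\setminus\{0\}\}<\infty$. *)

theory Defs
  imports "HOL-Analysis.Analysis" "HOL-Probability.Essential_Supremum"
begin

text \<open>R^n is modelled by an arbitrary Euclidean space 'a (dimension DIM('a)),
  with Lebesgue measure. M^+ = Lebesgue measurable functions into [0,\<infinity>] (ennreal).\<close>

definition banach_function_norm :: "(('a::euclidean_space \<Rightarrow> ennreal) \<Rightarrow> ennreal) \<Rightarrow> bool" where
  "banach_function_norm \<rho> \<longleftrightarrow>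
    \<comment> \<open>(A1)\<close>
    (\<forall>f \<in> borel_measurable lebesgue. \<rho> f = 0 \<longleftrightarrow> (AE x in lebesgue. f x = 0)) \<and>
    (\<forall>f \<in> borel_measurable lebesgue. \<forall>c::real. c \<ge> 0 \<longrightarrow>
        \<rho> (\<lambda>x. ennreal c * f x) = ennreal c * \<rho> f) \<and>
    (\<forall>f \<in> borel_measurable lebesgue. \<forall>g \<in> borel_measurable lebesgue.
        \<rho> (\<lambda>x. f x + g x) \<le> \<rho> f + \<rho> g) \<and>
    \<comment> \<open>(A2)\<close>
    (\<forall>f \<in> borel_measurable lebesgue. \<forall>g \<in> borel_measurable lebesgue.
        (AE x in lebesgue. g x \<le> f x) \<longrightarrow> \<rho> g \<le> \<rho> f) \<and>
    \<comment> \<open>(A3)\<close>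
    (\<forall>F f. (\<forall>j. F j \<in> borel_measurable lebesgue) \<longrightarrow> f \<in> borel_measurable lebesgue \<longrightarrow>
        (AE x in lebesgue. incseq (\<lambda>j. F j x) \<and> (\<lambda>j. F j x) \<longlonglongrightarrow> f x) \<longrightarrow>
        incseq (\<lambda>j. \<rho> (F j)) \<and> (\<lambda>j. \<rho> (F j)) \<longlonglongrightarrow> \<rho> f) \<and>
    \<comment> \<open>(A4)\<close>
    (\<forall>E \<in> sets lebesgue. emeasure lebesgue E < \<infinity> \<longrightarrow> \<rho> (indicator E) < \<infinity>) \<and>
    \<comment> \<open>(A5)\<close>
    (\<forall>E \<in> sets lebesgue. emeasure lebesgue E < \<infinity> \<longrightarrow>
        (\<exists>C::real. \<forall>f \<in> borel_measurable lebesgue.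
            (\<integral>\<^sup>+ x \<in> E. f x \<partial>lebesgue) \<le> ennreal C * \<rho> f))"

definition assoc_norm :: "(('a::euclidean_space \<Rightarrow> ennreal) \<Rightarrow> ennreal) \<Rightarrow> ('a \<Rightarrow> ennreal) \<Rightarrow> ennreal" where
  "assoc_norm \<rho> g = (SUP f \<in> {f \<in> borel_measurable lebesgue. \<rho> f \<le> 1}.
       \<integral>\<^sup>+ x. f x * g x \<partial>lebesgue)"

definition in_bfs :: "(('a::euclidean_space \<Rightarrow> ennreal) \<Rightarrow> ennreal) \<Rightarrow> ('a \<Rightarrow> complex) \<Rightarrow> bool" where
  "in_bfs \<rho> f \<longleftrightarrow> f \<in> borel_measurable lebesgue \<and> \<rho> (\<lambda>x. ennreal (cmod (f x))) < \<infinity>"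

definition bfs_enorm :: "(('a::euclidean_space \<Rightarrow> ennreal) \<Rightarrow> ennreal) \<Rightarrow> ('a \<Rightarrow> complex) \<Rightarrow> ennreal" where
  "bfs_enorm \<rho> f = \<rho> (\<lambda>x. ennreal (cmod (f x)))"

definition square_integrable :: "('a::euclidean_space \<Rightarrow> complex) \<Rightarrow> bool" where
  "square_integrable u \<longleftrightarrow> u \<in> borel_measurable lebesgue \<and>
     (\<integral>\<^sup>+ x. ennreal ((cmod (u x))\<^sup>2) \<partial>lebesgue) < \<infinity>"

definition L2_norm_fun :: "('a::euclidean_space \<Rightarrow> complex) \<Rightarrow> real" where
  "L2_norm_fun u = sqrt (enn2real (\<integral>\<^sup>+ x. ennreal ((cmod (u x))\<^sup>2) \<partial>lebesgue))"

definition fourier_int :: "('a::euclidean_space \<Rightarrow> complex) \<Rightarrow> 'a \<Rightarrow> complex" where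
  "fourier_int u \<xi> = (\<integral> x. u x * exp (- (\<i> * complex_of_real (x \<bullet> \<xi>))) \<partial>lebesgue)"

definition inv_fourier_int :: "('a::euclidean_space \<Rightarrow> complex) \<Rightarrow> 'a \<Rightarrow> complex" where
  "inv_fourier_int v x = complex_of_real ((2 * pi) powr (- real DIM('a))) *
     (\<integral> \<xi>. v \<xi> * exp (\<i> * complex_of_real (x \<bullet> \<xi>)) \<partial>lebesgue)"

text \<open>Fourier transform on L^2 as L^2-limit of transforms of truncations to balls
  (defined up to a.e. equality).\<close>
definition fourier_L2 :: "('a::euclidean_space \<Rightarrow> complex) \<Rightarrow> 'a \<Rightarrow> complex" where
  "fourier_L2 u = (SOME g. square_integrable g \<and>
     (\<lambda>k::nat. L2_norm_fun (\<lambda>\<xi>. fourier_int (\<lambda>x. indicator (ball 0 (real k)) x * u x) \<xi> - g \<xi>))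
       \<longlonglongrightarrow> 0)"

definition inv_fourier_L2 :: "('a::euclidean_space \<Rightarrow> complex) \<Rightarrow> 'a \<Rightarrow> complex" where
  "inv_fourier_L2 v = (SOME g. square_integrable g \<and>
     (\<lambda>k::nat. L2_norm_fun (\<lambda>x. inv_fourier_int (\<lambda>\<xi>. indicator (ball 0 (real k)) \<xi> * v \<xi>) x - g x))
       \<longlonglongrightarrow> 0)"

definition multiplier_op :: "('a::euclidean_space \<Rightarrow> complex) \<Rightarrow> ('a \<Rightarrow> complex) \<Rightarrow> 'a \<Rightarrow> complex" where
  "multiplier_op a u = inv_fourier_L2 (\<lambda>\<xi>. a \<xi> * fourier_L2 u \<xi>)"

definition Linf_enorm :: "('a::euclidean_space \<Rightarrow> complex) \<Rightarrow> ereal" where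
  "Linf_enorm a = esssup lebesgue (\<lambda>x. ereal (cmod (a x)))"

definition in_Linf :: "('a::euclidean_space \<Rightarrow> complex) \<Rightarrow> bool" where
  "in_Linf a \<longleftrightarrow> a \<in> borel_measurable lebesgue \<and> Linf_enorm a < \<infinity>"

definition Linf_norm :: "('a::euclidean_space \<Rightarrow> complex) \<Rightarrow> real" where
  "Linf_norm a = real_of_ereal (Linf_enorm a)"

definition multiplier_enorm :: "(('a::euclidean_space \<Rightarrow> ennreal) \<Rightarrow> ennreal) \<Rightarrow> ('a \<Rightarrow> complex) \<Rightarrow> ennreal" where
  "multiplier_enorm \<rho> a = (SUP u \<in> {u. square_integrable u \<and> in_bfs \<rho> u \<and> \<not> (AE x in lebesgue. u x = 0)}.
       bfs_enorm \<rho> (multiplier_op a u) / bfs_enorm \<rho> u)"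

definition fourier_multipliers :: "(('a::euclidean_space \<Rightarrow> ennreal) \<Rightarrow> ennreal) \<Rightarrow> ('a \<Rightarrow> complex) set" where
  "fourier_multipliers \<rho> = {a. in_Linf a \<and> multiplier_enorm \<rho> a < \<infinity>}"

definition multiplier_norm :: "(('a::euclidean_space \<Rightarrow> ennreal) \<Rightarrow> ennreal) \<Rightarrow> ('a \<Rightarrow> complex) \<Rightarrow> real" where
  "multiplier_norm \<rho> a = enn2real (multiplier_enorm \<rho> a)"

end

(* With T = F^-1 a F and u the indicator of a small cube, Plancherel and Hoelder's inequality
   for rho and its associate norm give
     int |a|^(2k) |F u|^2 = int |F T^k u|^2 <= c int |T^k u|^2 <= c rho(|T^k u|) rho'(|T^k u|) <= C K^k
   for all k, where K is the product of the two multiplier norms. Hence |a|^2 <= K a.e. where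
   F u does not vanish, and every frequency is reached by a sufficiently small cube.

   Plancherel: regularising |F f|^2 by a Gaussian turns its integral into
   int int f(x) cnj(f(y)) k_s(x - y) with a heat kernel k_s. The inequality 2|f(x)f(y)| <= |f(x)|^2 + |f(y)|^2
   shows that F is bounded by (2 pi)^(n/2) on L^2, and Fatou's lemma that equality holds for
   indicators of boxes. Equality there forces F^-1 F u = u for such u, and the multiplication formula
   int (F u) v = int u (F v) transfers this to F F^-1 g = g for all g in L^2 by testing against boxes. *)

theory Submission
  imports Defs "HOL-Probability.Characteristic_Functions"
begin

section \<open>The space L2\<close>

text \<open>The powers T^k remove the constants: Hoelder, Plancherel and the norms of u contribute a
  factor independent of k, and only the growth rate K survives in the limit. For this, T^k u has to
  stay in the intersection of L2 with both spaces, over which the multiplier norms are suprema, and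
  F T^k u = a^k F u has to hold, which rests on F F^-1 = id on L2. The obstacle is that
  \<open>fourier_L2\<close> and \<open>inv_fourier_L2\<close> are choices of an L2-limit: they are
  determined only almost everywhere, and linearity is not built into them. Hence statements are
  phrased with AE and L2 norms, and identities are obtained from limits, norm bounds and the
  multiplication formula rather than from an algebra of operators. Indicators of boxes serve as test
  functions throughout: (A4) and (A5) give them finite norm in X and in X', their transforms are
  given by an actual integral, and being real-valued they satisfy F^-1 u = (2 pi)^(-n) cnj (F u)
  almost everywhere.\<close>

lemma integrable_real_bound:
  fixes f :: "'b \<Rightarrow> 'c::{banach, second_countable_topology}" and g :: "'b \<Rightarrow> real"
  assumes "integrable M g" "f \<in> borel_measurable M" "\<And>x. norm (f x) \<le> g x"
  shows "integrable M f"
proof (rule Bochner_Integration.integrable_bound[OF assms(1,2)])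
  show "AE x in M. norm (f x) \<le> norm (g x)"
    using assms(3) by (intro AE_I2) (smt (verit) real_norm_def)
qed

lemma square_integrable_measurable:
  "square_integrable f \<Longrightarrow> f \<in> borel_measurable lebesgue"
  by (simp add: square_integrable_def)

lemma square_integrable_iff:
  "square_integrable f \<longleftrightarrow> f \<in> borel_measurable lebesgue \<and> integrable lebesgue (\<lambda>x. (cmod (f x))\<^sup>2)"
  by (auto simp: square_integrable_def integrable_iff_bounded)

lemma L2_norm_fun_sq:
  assumes "square_integrable f"
  shows "(L2_norm_fun f)\<^sup>2 = (LINT x|lebesgue. (cmod (f x))\<^sup>2)"
  using assms
  by (simp add: L2_norm_fun_def square_integrable_iff nn_integral_eq_integral integral_nonneg_AE)

lemma nn_integral_L2:
  assumes "square_integrable f"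
  shows "(\<integral>\<^sup>+x. ennreal ((cmod (f x))\<^sup>2) \<partial>lebesgue) = ennreal ((L2_norm_fun f)\<^sup>2)"
  using assms
  by (simp add: L2_norm_fun_sq square_integrable_iff nn_integral_eq_integral)

lemma L2_norm_fun_nonneg: "0 \<le> L2_norm_fun f"
  by (simp add: L2_norm_fun_def)

lemma square_integrable_cmult:
  "square_integrable f \<Longrightarrow> square_integrable (\<lambda>x. c * f x)"
  by (auto simp: square_integrable_iff norm_mult power_mult_distrib)

lemma square_integrable_cnj:
  "square_integrable f \<Longrightarrow> square_integrable (\<lambda>x. cnj (f x))"
  unfolding square_integrable_iff
  by (auto intro!: borel_measurable_continuous_on[OF continuous_on_cnj[OF continuous_on_id]])

lemma square_integrable_bound:
  assumes "square_integrable f" "g \<in> borel_measurable lebesgue"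
    and "AE x in lebesgue. cmod (g x) \<le> C * cmod (f x)"
  shows "square_integrable g"
proof -
  have [measurable]: "g \<in> borel_measurable lebesgue" by fact
  have 1: "integrable lebesgue (\<lambda>x. C\<^sup>2 * (cmod (f x))\<^sup>2)"
    using assms(1) by (auto simp: square_integrable_iff)
  have 2: "AE x in lebesgue. norm ((cmod (g x))\<^sup>2) \<le> norm (C\<^sup>2 * (cmod (f x))\<^sup>2)"
    using assms(3)
  proof eventually_elim
    case (elim x)
    then have "(cmod (g x))\<^sup>2 \<le> (C * cmod (f x))\<^sup>2"
      by (intro power_mono) auto
    then show ?case by (simp add: power_mult_distrib)
  qed
  have "integrable lebesgue (\<lambda>x. (cmod (g x))\<^sup>2)"
    by (rule Bochner_Integration.integrable_bound[OF 1 _ 2]) measurable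
  then show ?thesis
    using assms(2) by (simp add: square_integrable_iff)
qed

lemma square_integrable_add:
  assumes "square_integrable f" "square_integrable g"
  shows "square_integrable (\<lambda>x. f x + g x)"
proof -
  have [measurable]: "f \<in> borel_measurable lebesgue" "g \<in> borel_measurable lebesgue"
    using assms by (auto simp: square_integrable_iff)
  have 1: "(cmod (f x + g x))\<^sup>2 \<le> 2 * (cmod (f x))\<^sup>2 + 2 * (cmod (g x))\<^sup>2" for x
  proof -
    have "(cmod (f x + g x))\<^sup>2 \<le> (cmod (f x) + cmod (g x))\<^sup>2"
      by (intro power_mono norm_triangle_ineq) auto
    also have "\<dots> \<le> 2 * (cmod (f x))\<^sup>2 + 2 * (cmod (g x))\<^sup>2"
      using sum_squares_bound[of "cmod (f x)" "cmod (g x)"] by (simp add: power2_sum)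
    finally show ?thesis .
  qed
  have 2: "integrable lebesgue (\<lambda>x. 2 * (cmod (f x))\<^sup>2 + 2 * (cmod (g x))\<^sup>2)"
    using assms by (auto simp: square_integrable_iff)
  have "integrable lebesgue (\<lambda>x. (cmod (f x + g x))\<^sup>2)"
    by (rule integrable_real_bound[OF 2]) (use 1 in simp_all)
  then show ?thesis
    by (simp add: square_integrable_iff)
qed

lemma square_integrable_diff:
  assumes "square_integrable f" "square_integrable g"
  shows "square_integrable (\<lambda>x. f x - g x)"
  using square_integrable_add[OF assms(1) square_integrable_cmult[OF assms(2), of "-1"]] by simp

lemma square_integrable_mult_integrable:
  assumes "square_integrable f" "square_integrable g"
  shows "integrable lebesgue (\<lambda>x. f x * g x)"
proof -
  have [measurable]: "f \<in> borel_measurable lebesgue" "g \<in> borel_measurable lebesgue"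
    using assms by (auto simp: square_integrable_iff)
  have 1: "cmod (f x * g x) \<le> (cmod (f x))\<^sup>2 + (cmod (g x))\<^sup>2" for x
    using sum_squares_bound[of "cmod (f x)" "cmod (g x)"] mult_nonneg_nonneg[OF norm_ge_zero norm_ge_zero, of "f x" "g x"]
    unfolding norm_mult by linarith
  have 2: "integrable lebesgue (\<lambda>x. (cmod (f x))\<^sup>2 + (cmod (g x))\<^sup>2)"
    using assms by (auto simp: square_integrable_iff)
  show ?thesis
    by (rule integrable_real_bound[OF 2 _ 1]) measurable
qed

lemma L2_Cauchy_Schwarz_abs:
  assumes "square_integrable f" "square_integrable g"
  shows "(LINT x|lebesgue. cmod (f x * g x)) \<le> L2_norm_fun f * L2_norm_fun g"
proof -
  have [measurable]: "f \<in> borel_measurable lebesgue" "g \<in> borel_measurable lebesgue"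
    using assms by (auto simp: square_integrable_iff)
  let ?I = "LINT x|lebesgue. cmod (f x * g x)"
  have I: "(\<integral>\<^sup>+x. ennreal (cmod (f x)) * ennreal (cmod (g x)) \<partial>lebesgue) = ennreal ?I"
    using nn_integral_eq_integral[OF integrable_norm[OF square_integrable_mult_integrable[OF assms]]]
    by (simp add: norm_mult ennreal_mult)
  have "ennreal (?I\<^sup>2) \<le> ennreal ((L2_norm_fun f)\<^sup>2) * ennreal ((L2_norm_fun g)\<^sup>2)"
    using Cauchy_Schwarz_nn_integral[of "\<lambda>x. ennreal (cmod (f x))" lebesgue "\<lambda>x. ennreal (cmod (g x))"]
    by (simp add: I ennreal_power integral_nonneg_AE nn_integral_L2[OF assms(1)] nn_integral_L2[OF assms(2)])
  then have "?I\<^sup>2 \<le> (L2_norm_fun f * L2_norm_fun g)\<^sup>2"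
    by (simp add: ennreal_mult[symmetric] power_mult_distrib)
  then show ?thesis
    by (rule power2_le_imp_le) (simp add: L2_norm_fun_nonneg)
qed

lemma L2_Cauchy_Schwarz:
  assumes "square_integrable f" "square_integrable g"
  shows "cmod (LINT x|lebesgue. f x * g x) \<le> L2_norm_fun f * L2_norm_fun g"
  by (rule order_trans[OF integral_norm_bound L2_Cauchy_Schwarz_abs[OF assms]])

lemma L2_norm_fun_triangle:
  assumes "square_integrable f" "square_integrable g"
  shows "L2_norm_fun (\<lambda>x. f x + g x) \<le> L2_norm_fun f + L2_norm_fun g"
proof (rule power2_le_imp_le)
  have i: "integrable lebesgue (\<lambda>x. (cmod (f x))\<^sup>2)" "integrable lebesgue (\<lambda>x. (cmod (g x))\<^sup>2)"
    using assms by (auto simp: square_integrable_iff)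
  have i': "integrable lebesgue (\<lambda>x. cmod (f x * g x))"
    by (rule integrable_norm[OF square_integrable_mult_integrable[OF assms]])
  have "(L2_norm_fun (\<lambda>x. f x + g x))\<^sup>2 = (LINT x|lebesgue. (cmod (f x + g x))\<^sup>2)"
    by (rule L2_norm_fun_sq[OF square_integrable_add[OF assms]])
  also have "\<dots> \<le> (LINT x|lebesgue. (cmod (f x))\<^sup>2 + (cmod (g x))\<^sup>2 + 2 * cmod (f x * g x))"
  proof (rule integral_mono)
    show "integrable lebesgue (\<lambda>x. (cmod (f x + g x))\<^sup>2)"
      using square_integrable_add[OF assms] by (simp add: square_integrable_iff)
    show "integrable lebesgue (\<lambda>x. (cmod (f x))\<^sup>2 + (cmod (g x))\<^sup>2 + 2 * cmod (f x * g x))"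
      by (intro Bochner_Integration.integrable_add integrable_mult_right i i')
    fix x
    have "(cmod (f x + g x))\<^sup>2 \<le> (cmod (f x) + cmod (g x))\<^sup>2"
      by (intro power_mono norm_triangle_ineq) auto
    then show "(cmod (f x + g x))\<^sup>2 \<le> (cmod (f x))\<^sup>2 + (cmod (g x))\<^sup>2 + 2 * cmod (f x * g x)"
      by (simp add: power2_sum norm_mult)
  qed
  also have "\<dots> = (L2_norm_fun f)\<^sup>2 + (L2_norm_fun g)\<^sup>2 + 2 * (LINT x|lebesgue. cmod (f x * g x))"
    using i i' by (simp add: L2_norm_fun_sq assms del: norm_mult)
  also have "\<dots> \<le> (L2_norm_fun f + L2_norm_fun g)\<^sup>2"
    using L2_Cauchy_Schwarz_abs[OF assms] by (simp add: power2_sum)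
  finally show "(L2_norm_fun (\<lambda>x. f x + g x))\<^sup>2 \<le> (L2_norm_fun f + L2_norm_fun g)\<^sup>2" .
qed (simp add: L2_norm_fun_nonneg)

lemma L2_norm_fun_commute: "L2_norm_fun (\<lambda>x. f x - g x) = L2_norm_fun (\<lambda>x. g x - f x)"
  by (simp add: L2_norm_fun_def norm_minus_commute)

lemma L2_norm_fun_cmult:
  assumes "square_integrable f"
  shows "L2_norm_fun (\<lambda>x. c * f x) = cmod c * L2_norm_fun f"
proof -
  have "(\<lambda>x. ennreal ((cmod (f x))\<^sup>2)) \<in> borel_measurable lebesgue"
    using square_integrable_measurable[OF assms] by measurable
  then show ?thesis
    by (simp add: L2_norm_fun_def norm_mult power_mult_distrib ennreal_mult nn_integral_cmult
        enn2real_mult real_sqrt_mult)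
qed

lemma L2_norm_fun_cnj: "L2_norm_fun (\<lambda>x. cnj (f x)) = L2_norm_fun f"
  by (simp add: L2_norm_fun_def)

lemma L2_norm_fun_triangle_diff:
  assumes "square_integrable f" "square_integrable g"
  shows "L2_norm_fun f \<le> L2_norm_fun g + L2_norm_fun (\<lambda>x. f x - g x)"
  using L2_norm_fun_triangle[OF assms(2) square_integrable_diff[OF assms]] by simp

lemma L2_norm_fun_eq_0_AE:
  assumes "square_integrable f" "L2_norm_fun f = 0"
  shows "AE x in lebesgue. f x = 0"
proof -
  have "(\<lambda>x. ennreal ((cmod (f x))\<^sup>2)) \<in> borel_measurable lebesgue"
    using square_integrable_measurable[OF assms(1)] by measurable
  then show ?thesis
    using nn_integral_L2[OF assms(1)] assms(2) by (simp add: nn_integral_0_iff_AE)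
qed

lemma L2_norm_fun_AE_cong:
  assumes "AE x in lebesgue. f x = g x"
  shows "L2_norm_fun f = L2_norm_fun g"
proof -
  have "(\<integral>\<^sup>+ x. ennreal ((cmod (f x))\<^sup>2) \<partial>lebesgue) = (\<integral>\<^sup>+ x. ennreal ((cmod (g x))\<^sup>2) \<partial>lebesgue)"
    using assms by (intro nn_integral_cong_AE) auto
  then show ?thesis by (simp add: L2_norm_fun_def)
qed

section \<open>Convergence, truncation and completeness in L2\<close>

lemma tendsto_norm_bound:
  fixes F :: "nat \<Rightarrow> 'b::real_normed_vector"
  assumes "\<And>k. norm (F k - l) \<le> D k" "D \<longlonglongrightarrow> 0"
  shows "F \<longlonglongrightarrow> l"
proof -
  have "(\<lambda>k. F k - l) \<longlonglongrightarrow> 0"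
    by (rule Lim_null_comparison[OF always_eventually assms(2)]) (use assms(1) in blast)
  then show ?thesis
    by (simp add: LIM_zero_iff)
qed

lemma L2_norm_fun_tendsto:
  assumes "\<And>k. square_integrable (F k)" "square_integrable f"
    and "(\<lambda>k. L2_norm_fun (\<lambda>x. F k x - f x)) \<longlonglongrightarrow> 0"
  shows "(\<lambda>k. L2_norm_fun (F k)) \<longlonglongrightarrow> L2_norm_fun f"
proof -
  have "norm (L2_norm_fun (F k) - L2_norm_fun f) \<le> L2_norm_fun (\<lambda>x. F k x - f x)" for k
    using L2_norm_fun_triangle_diff[OF assms(1,2), of k] L2_norm_fun_triangle_diff[OF assms(2,1), of k]
    by (simp add: L2_norm_fun_commute[of f])
  then show ?thesis
    using assms(3) by (rule tendsto_norm_bound)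
qed

lemma L2_integral_mult_tendsto:
  assumes F: "\<And>k. square_integrable (F k)" "square_integrable f"
    "(\<lambda>k. L2_norm_fun (\<lambda>x. F k x - f x)) \<longlonglongrightarrow> 0"
    and G: "\<And>k. square_integrable (G k)" "square_integrable g"
    "(\<lambda>k. L2_norm_fun (\<lambda>x. G k x - g x)) \<longlonglongrightarrow> 0"
  shows "(\<lambda>k. LINT x|lebesgue. F k x * G k x) \<longlonglongrightarrow> (LINT x|lebesgue. f x * g x)"
proof -
  \<comment> \<open>F G - f g = (F - f) G + f (G - g), and Cauchy-Schwarz bounds the integrals of
    the two summands by the two terms of D. The factor \<open>L2_norm_fun (G k)\<close> converges,
    so D tends to 0.\<close>
  define D where "D k = L2_norm_fun (\<lambda>x. F k x - f x) * L2_norm_fun (G k) +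
    L2_norm_fun f * L2_norm_fun (\<lambda>x. G k x - g x)" for k
  have "D \<longlonglongrightarrow> 0 * L2_norm_fun g + L2_norm_fun f * 0"
    unfolding D_def by (intro tendsto_intros assms L2_norm_fun_tendsto)
  then have D: "D \<longlonglongrightarrow> 0" by simp
  have "norm ((LINT x|lebesgue. F k x * G k x) - (LINT x|lebesgue. f x * g x)) \<le> D k" for k
  proof -
    note d = square_integrable_diff[OF F(1)[of k] F(2)] square_integrable_diff[OF G(1)[of k] G(2)]
    have "(LINT x|lebesgue. F k x * G k x) - (LINT x|lebesgue. f x * g x)
      = (LINT x|lebesgue. (F k x - f x) * G k x + f x * (G k x - g x))"
      by (subst Bochner_Integration.integral_diff[symmetric])
         (simp_all add: square_integrable_mult_integrable F G algebra_simps)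
    also have "\<dots> = (LINT x|lebesgue. (F k x - f x) * G k x) + (LINT x|lebesgue. f x * (G k x - g x))"
      by (intro Bochner_Integration.integral_add square_integrable_mult_integrable F G d)
    also have "norm \<dots> \<le> D k"
      unfolding D_def
      by (intro norm_triangle_mono L2_Cauchy_Schwarz F G d)
    finally show ?thesis .
  qed
  then show ?thesis
    using D by (rule tendsto_norm_bound)
qed

lemma L2_truncation_tendsto:
  fixes u :: "'a::euclidean_space \<Rightarrow> complex"
  assumes "square_integrable u"
  shows "(\<lambda>k. L2_norm_fun (\<lambda>x. indicator (ball 0 (real k)) x * u x - u x)) \<longlonglongrightarrow> 0"
proof -
  have [measurable]: "u \<in> borel_measurable lebesgue"
    using assms by (auto simp: square_integrable_iff)
  have [measurable]: "ball (0::'a) r \<in> sets lebesgue" for r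
    by (simp add: fmeasurableD)
  have s: "square_integrable (\<lambda>x. indicator (ball 0 (real k)) x * u x - u x)" for k
    by (rule square_integrable_bound[OF assms, where C = 1]) (auto split: split_indicator)
  have "(\<lambda>k. LINT x|lebesgue. (cmod (indicator (ball 0 (real k)) x * u x - u x))\<^sup>2) \<longlonglongrightarrow> (LINT x|(lebesgue::'a measure). 0)"
  proof (rule integral_dominated_convergence)
    show "integrable lebesgue (\<lambda>x. (cmod (u x))\<^sup>2)"
      using assms by (simp add: square_integrable_iff)
    show "AE x in lebesgue. (\<lambda>k. (cmod (indicator (ball 0 (real k)) x * u x - u x))\<^sup>2) \<longlonglongrightarrow> 0"
    proof (rule AE_I2, rule tendsto_eventually)
      fix x :: 'a
      show "\<forall>\<^sub>F k in sequentially. (cmod (indicator (ball 0 (real k)) x * u x - u x))\<^sup>2 = 0"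
        using eventually_gt_at_top[of "nat \<lceil>norm x\<rceil>"]
      proof eventually_elim
        case (elim k)
        then have "norm x < real k" by linarith
        then show ?case by simp
      qed
    qed
  qed (auto split: split_indicator)
  then have "(\<lambda>k. sqrt ((L2_norm_fun (\<lambda>x. indicator (ball 0 (real k)) x * u x - u x))\<^sup>2)) \<longlonglongrightarrow> sqrt 0"
    by (intro tendsto_real_sqrt) (simp add: L2_norm_fun_sq[OF s])
  then show ?thesis
    by (simp add: L2_norm_fun_nonneg)
qed

lemma nn_integral_L2_le:
  assumes "square_integrable f" "L2_norm_fun f \<le> e"
  shows "(\<integral>\<^sup>+x. ennreal ((cmod (f x))\<^sup>2) \<partial>lebesgue) \<le> ennreal (e\<^sup>2)"
  unfolding nn_integral_L2[OF assms(1)]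
  by (intro ennreal_leI power_mono assms L2_norm_fun_nonneg)

text \<open>Riesz-Fischer: a rapidly converging subsequence converges almost everywhere, and Fatou's
  lemma along it shows that its limit is the L2-limit of the whole sequence.\<close>

lemma L2_complete:
  fixes F :: "nat \<Rightarrow> 'a::euclidean_space \<Rightarrow> complex"
  assumes sq: "\<And>k. square_integrable (F k)"
    and cauchy: "\<And>e. e > 0 \<Longrightarrow> \<exists>N. \<forall>m\<ge>N. \<forall>n\<ge>N. L2_norm_fun (\<lambda>x. F m x - F n x) < e"
  shows "\<exists>g. square_integrable g \<and> (\<lambda>k. L2_norm_fun (\<lambda>x. F k x - g x)) \<longlonglongrightarrow> 0"
proof -
  have [measurable]: "F k \<in> borel_measurable lebesgue" for k
    using sq by (rule square_integrable_measurable)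
  have "\<exists>N. \<forall>j. \<forall>m\<ge>N j. \<forall>n\<ge>N j. L2_norm_fun (\<lambda>x. F m x - F n x) < (1/2) ^ j"
    by (intro choice allI cauchy) simp
  then obtain N where N: "\<And>j m n. N j \<le> m \<Longrightarrow> N j \<le> n \<Longrightarrow> L2_norm_fun (\<lambda>x. F m x - F n x) < (1/2) ^ j"
    by blast
  \<comment> \<open>The partial sums of N dominate every N i with i \<le> j, so both r j and r (Suc
    j) are at least N j.\<close>
  define r where "r j = (\<Sum>i\<le>j. N i)" for j
  have r: "N i \<le> r j" if "i \<le> j" for i j
    unfolding r_def using that by (intro member_le_sum) auto
  define d where "d j x = F (r (Suc j)) x - F (r j) x" for j x
  \<comment> \<open>The weight 2^j balances two needs. The squared L2 norm of d j is at most 4^(-j),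
    so the integrals still sum to a finite value; and finiteness of S at x forces |d j x| \<le> sqrt
    (S x) 2^(-j/2), a summable geometric bound at that point.\<close>
  define S where "S x = (\<Sum>j. ennreal (2 ^ j * (cmod (d j x))\<^sup>2))" for x
  have d_meas [measurable]: "d j \<in> borel_measurable lebesgue" for j
    unfolding d_def by measurable
  have dsq: "square_integrable (d j)" for j
    unfolding d_def by (intro square_integrable_diff sq)
  have term_bound: "(\<integral>\<^sup>+x. ennreal (2 ^ j * (cmod (d j x))\<^sup>2) \<partial>lebesgue) \<le> ennreal ((1/2) ^ j)" for j
  proof -
    have "L2_norm_fun (d j) \<le> (1/2) ^ j"
      unfolding d_def by (rule less_imp_le, rule N) (auto intro: r)
    from nn_integral_L2_le[OF dsq this]
    have "ennreal (2 ^ j) * (\<integral>\<^sup>+x. ennreal ((cmod (d j x))\<^sup>2) \<partial>lebesgue) \<le> ennreal (2 ^ j) * ennreal (((1/2) ^ j)\<^sup>2)"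
      by (rule mult_left_mono) simp
    also have "\<dots> = ennreal ((1/2) ^ j)"
      by (simp add: ennreal_mult[symmetric] power2_eq_square power_one_over)
    finally show ?thesis
      by (simp add: ennreal_mult nn_integral_cmult)
  qed
  have "(\<integral>\<^sup>+x. S x \<partial>lebesgue) = (\<Sum>j. \<integral>\<^sup>+x. ennreal (2 ^ j * (cmod (d j x))\<^sup>2) \<partial>lebesgue)"
    unfolding S_def by (intro nn_integral_suminf) measurable
  also have "\<dots> \<le> (\<Sum>j. ennreal ((1/2) ^ j))"
    by (intro suminf_le term_bound) auto
  also have "\<dots> = ennreal (\<Sum>j. (1/2) ^ j)"
    by (intro suminf_ennreal2) (auto intro: summable_geometric)
  also have "\<dots> < \<infinity>"
    by simp
  finally have Sfin: "(\<integral>\<^sup>+x. S x \<partial>lebesgue) \<noteq> \<infinity>"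
    by simp
  have S_meas: "S \<in> borel_measurable lebesgue"
    unfolding S_def by measurable
  define g where "g x = lim (\<lambda>j. F (r j) x)" for x
  have g_meas [measurable]: "g \<in> borel_measurable lebesgue"
    unfolding g_def by measurable
  have conv: "AE x in lebesgue. (\<lambda>j. F (r j) x) \<longlonglongrightarrow> g x"
    using nn_integral_PInf_AE[OF S_meas Sfin]
  proof eventually_elim
    case (elim x)
    define s where "s = enn2real (S x)"
    have s: "S x = ennreal s" "0 \<le> s"
      using elim by (auto simp: s_def less_top)
    have bnd: "cmod (d j x) \<le> sqrt s * (sqrt (1/2)) ^ j" for j
    proof -
      have "ennreal (2 ^ j * (cmod (d j x))\<^sup>2) = (\<Sum>i\<in>{j}. ennreal (2 ^ i * (cmod (d i x))\<^sup>2))"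
        by simp
      also have "\<dots> \<le> S x"
        unfolding S_def by (intro sum_le_suminf) auto
      finally have "2 ^ j * (cmod (d j x))\<^sup>2 \<le> s"
        by (simp add: s)
      then have "(cmod (d j x))\<^sup>2 \<le> s * (1/2) ^ j"
        by (simp add: field_simps power_one_over)
      then have "sqrt ((cmod (d j x))\<^sup>2) \<le> sqrt (s * (1/2) ^ j)"
        by (rule real_sqrt_le_mono)
      then show ?thesis
        by (simp add: real_sqrt_mult real_sqrt_power)
    qed
    have "summable (\<lambda>j. sqrt s * (sqrt (1/2)) ^ j)"
      by (intro summable_mult summable_geometric) (simp add: real_sqrt_lt_1_iff)
    then have "summable (\<lambda>j. d j x)"
      by (rule summable_comparison_test'[where N = 0]) (use bnd in simp)
    then have "convergent (\<lambda>n. \<Sum>j<n. d j x)"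
      by (simp add: summable_iff_convergent)
    then have "convergent (\<lambda>n. (\<Sum>j<n. d j x) + F (r 0) x)"
      by (intro convergent_add convergent_const)
    moreover have "(\<Sum>j<n. d j x) + F (r 0) x = F (r n) x" for n
      unfolding d_def by (simp add: sum_lessThan_telescope[of "\<lambda>n. F (r n) x"])
    ultimately show ?case
      unfolding g_def by (simp add: convergent_LIMSEQ_iff)
  qed
  \<comment> \<open>Fatou's lemma in the subsequence index i with m fixed: F (r i) tends to g, and r
    i \<ge> N j for i \<ge> j keeps the integrals below the Cauchy bound.\<close>
  have bound: "(\<integral>\<^sup>+x. ennreal ((cmod (F m x - g x))\<^sup>2) \<partial>lebesgue) \<le> ennreal (((1/2) ^ j)\<^sup>2)"
    if "N j \<le> m" for m j
  proof -
    have "(\<integral>\<^sup>+x. ennreal ((cmod (F m x - g x))\<^sup>2) \<partial>lebesgue)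
      = (\<integral>\<^sup>+x. liminf (\<lambda>i. ennreal ((cmod (F m x - F (r i) x))\<^sup>2)) \<partial>lebesgue)"
    proof (rule nn_integral_cong_AE, use conv in eventually_elim)
      fix x assume "(\<lambda>j. F (r j) x) \<longlonglongrightarrow> g x"
      then have "(\<lambda>i. ennreal ((cmod (F m x - F (r i) x))\<^sup>2)) \<longlonglongrightarrow> ennreal ((cmod (F m x - g x))\<^sup>2)"
        by (intro tendsto_ennrealI tendsto_intros)
      from lim_imp_Liminf[OF _ this]
      show "ennreal ((cmod (F m x - g x))\<^sup>2) = liminf (\<lambda>i. ennreal ((cmod (F m x - F (r i) x))\<^sup>2))"
        by simp
    qed
    also have "\<dots> \<le> liminf (\<lambda>i. \<integral>\<^sup>+x. ennreal ((cmod (F m x - F (r i) x))\<^sup>2) \<partial>lebesgue)"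
      by (rule nn_integral_liminf) measurable
    also have "\<dots> \<le> limsup (\<lambda>i. \<integral>\<^sup>+x. ennreal ((cmod (F m x - F (r i) x))\<^sup>2) \<partial>lebesgue)"
      by (rule Liminf_le_Limsup) simp
    also have "\<dots> \<le> ennreal (((1/2) ^ j)\<^sup>2)"
    proof (rule Limsup_bounded)
      show "\<forall>\<^sub>F i in sequentially. (\<integral>\<^sup>+x. ennreal ((cmod (F m x - F (r i) x))\<^sup>2) \<partial>lebesgue) \<le> ennreal (((1/2) ^ j)\<^sup>2)"
        using eventually_ge_at_top[of j]
      proof eventually_elim
        case (elim i)
        show ?case
          by (intro nn_integral_L2_le square_integrable_diff sq, rule less_imp_le, rule N) (auto intro: that r elim)
      qed
    qed
    finally show ?thesis .
  qed
  have Fg: "square_integrable (\<lambda>x. F m x - g x)" if "N j \<le> m" for m j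
    unfolding square_integrable_def
    using bound[OF that] by (auto intro: le_less_trans)
  \<comment> \<open>g = F (N 0) - (F (N 0) - g), a difference of two L2 functions.\<close>
  have g: "square_integrable g"
    using square_integrable_diff[OF sq[of "N 0"] Fg[of 0 "N 0"]] by simp
  have le: "L2_norm_fun (\<lambda>x. F m x - g x) \<le> (1/2) ^ j" if "N j \<le> m" for m j
  proof (rule power2_le_imp_le)
    show "(L2_norm_fun (\<lambda>x. F m x - g x))\<^sup>2 \<le> ((1/2) ^ j)\<^sup>2"
      using bound[OF that] unfolding nn_integral_L2[OF Fg[OF that]] by simp
  qed simp
  have "(\<lambda>k. L2_norm_fun (\<lambda>x. F k x - g x)) \<longlonglongrightarrow> 0"
  proof (rule LIMSEQ_I)
    fix e :: real assume "e > 0"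
    then obtain j where j: "(1/2) ^ j < e"
      using real_arch_pow_inv[of e "1/2"] by auto
    have "norm (L2_norm_fun (\<lambda>x. F m x - g x) - 0) < e" if "m \<ge> N j" for m
      using le[OF that] j L2_norm_fun_nonneg[of "\<lambda>x. F m x - g x"] by simp
    then show "\<exists>n0. \<forall>m\<ge>n0. norm (L2_norm_fun (\<lambda>x. F m x - g x) - 0) < e"
      by blast
  qed
  with g show ?thesis by blast
qed

section \<open>Gaussians\<close>

text \<open>The parameter s is an inverse width: the function tends to 1 pointwise as s
  \<rightarrow> 0, which makes it a removable regulariser. It is polymorphic in the space, so the
  coordinate factors in \<open>gauss_prod\<close> are its instances on the real line.\<close>

definition gauss :: "real \<Rightarrow> 'a::euclidean_space \<Rightarrow> real" where
  "gauss s x = exp (- (s * norm x)\<^sup>2 / 2)"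

lemma gauss_nonneg: "0 \<le> gauss s x" by (simp add: gauss_def)

lemma gauss_le_1: "gauss s x \<le> 1" by (simp add: gauss_def)

lemma gauss_measurable [measurable]: "gauss s \<in> borel_measurable borel"
  unfolding gauss_def by measurable

text \<open>The substitution y = s x reduces this to the characteristic function of the standard
  normal distribution, evaluated at t / s.\<close>

lemma gauss_real_fourier:
  fixes s t :: real
  assumes "s > 0"
  shows "integrable lborel (\<lambda>x. complex_of_real (gauss s x) * exp (\<i> * of_real (t * x)))"
    and "(LINT x|lborel. complex_of_real (gauss s x) * exp (\<i> * of_real (t * x)))
      = of_real (sqrt (2 * pi) / s * gauss (1/s) t)"
proof -
  \<comment> \<open>The redundant 0 + s * x matches the affine change of variables for the Lebesgue
    integral on the line.\<close>
  have eq: "complex_of_real (gauss s x) * exp (\<i> * of_real (t * x))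
    = of_real (sqrt (2 * pi)) * (std_normal_density (0 + s * x) *\<^sub>R iexp (t / s * (0 + s * x)))" for x
  proof -
    have "(s * \<bar>x\<bar>)\<^sup>2 = (s * x)\<^sup>2"
      by (simp only: power_mult_distrib power2_abs)
    then show ?thesis
      using assms by (simp add: gauss_def std_normal_density_def scaleR_conv_of_real)
  qed
  have i: "integrable lborel (\<lambda>x. std_normal_density x *\<^sub>R iexp (t / s * x))"
    by (rule Bochner_Integration.integrable_bound[OF integrable_normal_density[of 1 0]]) (auto simp: normal_density_nonneg)
  then have i2: "integrable lborel (\<lambda>x. std_normal_density (0 + s * x) *\<^sub>R iexp (t / s * (0 + s * x)))"
    using assms by (intro lborel_integrable_real_affine[of "\<lambda>x. std_normal_density x *\<^sub>R iexp (t / s * x)" s 0]) auto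
  then show "integrable lborel (\<lambda>x. complex_of_real (gauss s x) * exp (\<i> * of_real (t * x)))"
    unfolding eq by (rule integrable_mult_right)
  have "char std_normal_distribution (t / s) = (LINT x|lborel. std_normal_density x *\<^sub>R iexp (t / s * x))"
    unfolding char_def by (subst integral_density) auto
  also have "\<dots> = \<bar>s\<bar> *\<^sub>R (LINT x|lborel. std_normal_density (0 + s * x) *\<^sub>R iexp (t / s * (0 + s * x)))"
    using assms by (intro lborel_integral_real_affine) auto
  finally have "(LINT x|lborel. std_normal_density (0 + s * x) *\<^sub>R iexp (t / s * (0 + s * x)))
     = of_real (exp (- (t / s)\<^sup>2 / 2)) / of_real s"
    using assms by (simp add: char_std_normal_distribution scaleR_conv_of_real field_simps)
  then show "(LINT x|lborel. complex_of_real (gauss s x) * exp (\<i> * of_real (t * x)))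
      = of_real (sqrt (2 * pi) / s * gauss (1/s) t)"
    unfolding eq integral_mult_right_zero
    by (simp add: gauss_def power_divide)
qed

text \<open>Lebesgue measure is the image of the product of one-dimensional Lebesgue measures under
  the coordinate map, so the integral of a product over coordinates factors. It lifts the Gaussian
  transform from dimension one.\<close>

lemma integral_lborel_prod:
  fixes f :: "'a::euclidean_space \<Rightarrow> real \<Rightarrow> complex"
  assumes i: "\<And>b. b \<in> Basis \<Longrightarrow> integrable lborel (f b)"
  shows "integrable lborel (\<lambda>x. \<Prod>b\<in>Basis. f b (x \<bullet> b))"
    and "(LINT x|lborel. (\<Prod>b\<in>Basis. f b (x \<bullet> b))) = (\<Prod>b\<in>Basis. LINT x|lborel. f b x)"
proof -
  interpret product_sigma_finite "\<lambda>_::'a. lborel :: real measure" ..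
  have m [measurable]: "f b \<in> borel_measurable borel" if "b \<in> Basis" for b
    using i[OF that] by auto
  have T [measurable]: "(\<lambda>f. \<Sum>b\<in>Basis. f b *\<^sub>R b) \<in> (\<Pi>\<^sub>M b\<in>(Basis::'a set). (lborel::real measure)) \<rightarrow>\<^sub>M borel"
    by measurable
  have P [measurable]: "(\<lambda>x. \<Prod>b\<in>Basis. f b (x \<bullet> b)) \<in> borel_measurable (borel::'a measure)"
    by measurable
  have e: "(\<Prod>b\<in>Basis. f b ((\<Sum>b\<in>Basis. x b *\<^sub>R b) \<bullet> b)) = (\<Prod>b\<in>Basis. f b (x b))" for x
    by (intro prod.cong) (auto simp: inner_sum_left_Basis)
  show "integrable lborel (\<lambda>x. \<Prod>b\<in>Basis. f b (x \<bullet> b))"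
    by (subst lborel_eq, subst integrable_distr_eq[OF T P])
       (simp only: e, intro product_integrable_prod i finite_Basis)
  show "(LINT x|lborel. (\<Prod>b\<in>Basis. f b (x \<bullet> b))) = (\<Prod>b\<in>Basis. LINT x|lborel. f b x)"
    by (subst lborel_eq, subst integral_distr[OF T P])
       (simp only: e, intro product_integral_prod i finite_Basis)
qed

lemma gauss_prod: "gauss s x = (\<Prod>b\<in>Basis. gauss s (x \<bullet> b))"
proof -
  have "(norm x)\<^sup>2 = (\<Sum>b\<in>Basis. (x \<bullet> b)\<^sup>2)"
    by (simp add: norm_eq_sqrt_inner euclidean_inner[of x x] power2_eq_square sum_nonneg)
  then show ?thesis
    by (simp add: gauss_def exp_sum[symmetric] power_mult_distrib sum_distrib_left sum_negf sum_divide_distrib)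
qed

lemma gauss_fourier:
  fixes z :: "'a::euclidean_space"
  assumes "s > 0"
  shows "integrable lborel (\<lambda>x. complex_of_real (gauss s x) * exp (\<i> * of_real (z \<bullet> x)))"
    and "(LINT x|lborel. complex_of_real (gauss s x) * exp (\<i> * of_real (z \<bullet> x)))
      = of_real ((sqrt (2 * pi) / s) ^ DIM('a) * gauss (1/s) z)"
proof -
  let ?f = "\<lambda>b x. complex_of_real (gauss s x) * exp (\<i> * of_real ((z \<bullet> b) * x))"
  have eq: "complex_of_real (gauss s x) * exp (\<i> * of_real (z \<bullet> x)) = (\<Prod>b\<in>Basis. ?f b (x \<bullet> b))" for x
    by (simp add: prod.distrib gauss_prod[of s x] euclidean_inner[of z x] sum_distrib_left exp_sum)
  show "integrable lborel (\<lambda>x. complex_of_real (gauss s x) * exp (\<i> * of_real (z \<bullet> x)))"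
    unfolding eq using assms by (intro integral_lborel_prod gauss_real_fourier)
  have "(LINT x|lborel. complex_of_real (gauss s x) * exp (\<i> * of_real (z \<bullet> x)))
    = (\<Prod>b\<in>(Basis::'a set). complex_of_real (sqrt (2 * pi) / s * gauss (1/s) (z \<bullet> b)))"
    unfolding eq using assms by (subst integral_lborel_prod) (simp_all only: gauss_real_fourier)
  also have "\<dots> = of_real ((sqrt (2 * pi) / s) ^ DIM('a) * gauss (1/s) z)"
    by (simp add: prod.distrib prod_dividef power_divide gauss_prod[of "1/s" z])
  finally show "(LINT x|lborel. complex_of_real (gauss s x) * exp (\<i> * of_real (z \<bullet> x)))
      = of_real ((sqrt (2 * pi) / s) ^ DIM('a) * gauss (1/s) z)" .
qed

lemma gauss_nn_integral:
  assumes "s > 0"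
  shows "(\<integral>\<^sup>+x. ennreal (gauss s (x::'a::euclidean_space)) \<partial>lborel) = ennreal ((sqrt (2 * pi) / s) ^ DIM('a))"
proof -
  have "integrable lborel (\<lambda>x::'a. complex_of_real (gauss s x))"
    using gauss_fourier(1)[OF assms, of 0] by simp
  then have i: "integrable lborel (gauss s :: 'a \<Rightarrow> real)"
    by (simp add: complex_of_real_integrable_eq)
  have "complex_of_real (LINT x::'a|lborel. gauss s x) = of_real ((sqrt (2 * pi) / s) ^ DIM('a))"
    using gauss_fourier(2)[OF assms, of "0::'a"] by (simp add: gauss_def)
  then have "(LINT x::'a|lborel. gauss s x) = (sqrt (2 * pi) / s) ^ DIM('a)"
    by (rule of_real_eq_iff[THEN iffD1])
  then show "(\<integral>\<^sup>+x. ennreal (gauss s (x::'a)) \<partial>lborel) = ennreal ((sqrt (2 * pi) / s) ^ DIM('a))"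
    using nn_integral_eq_integral[OF i] by (simp add: gauss_nonneg)
qed

lemma nn_integral_lborel_affine:
  fixes f :: "'a::euclidean_space \<Rightarrow> ennreal"
  assumes [measurable]: "f \<in> borel_measurable borel" and "c \<noteq> 0"
  shows "(\<integral>\<^sup>+x. f x \<partial>lborel) = ennreal (\<bar>c\<bar> ^ DIM('a)) * (\<integral>\<^sup>+x. f (t + c *\<^sub>R x) \<partial>lborel)"
  by (subst lborel_affine[OF assms(2), of t])
     (simp add: nn_integral_density nn_integral_distr nn_integral_cmult)

section \<open>The Fourier integral\<close>

lemma measurable_lebesgue_ident [measurable]: "(\<lambda>x. x) \<in> lebesgue \<rightarrow>\<^sub>M (borel::'a::euclidean_space measure)"
  by (rule measurable_completion) simp

lemma measurable_fst_lebesgue_borel [measurable]: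
  "fst \<in> (lebesgue \<Otimes>\<^sub>M M) \<rightarrow>\<^sub>M (borel::'a::euclidean_space measure)"
  by (rule measurable_compose[OF measurable_fst measurable_lebesgue_ident])

lemma measurable_snd_lebesgue_borel [measurable]:
  "snd \<in> (M \<Otimes>\<^sub>M lebesgue) \<rightarrow>\<^sub>M (borel::'a::euclidean_space measure)"
  by (rule measurable_compose[OF measurable_snd measurable_lebesgue_ident])

lemma sigma_finite_lebesgue: "sigma_finite_measure (lebesgue :: 'a::euclidean_space measure)"
proof
  obtain A :: "'a set set" where A: "countable A" "A \<subseteq> sets lborel" "\<Union>A = space lborel"
      "\<forall>a\<in>A. emeasure lborel a \<noteq> \<infinity>"
    using lborel.sigma_finite_countable by blast
  have "emeasure lebesgue a \<noteq> \<infinity>" if "a \<in> A" for a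
  proof -
    have "a \<in> sets lborel"
      using A(2) that by blast
    then have "emeasure lebesgue a = emeasure lborel a"
      by simp
    with A(4) that show ?thesis by simp
  qed
  moreover have "A \<subseteq> sets lebesgue"
    using A(2) sets_completionI_sets by blast
  ultimately show "\<exists>A::'a set set. countable A \<and> A \<subseteq> sets lebesgue \<and> \<Union>A = space lebesgue \<and> (\<forall>a\<in>A. emeasure lebesgue a \<noteq> \<infinity>)"
    using A(1,3) by (intro exI[of _ A]) simp
qed

interpretation lebesgue: sigma_finite_measure "lebesgue :: 'a::euclidean_space measure"
  by (rule sigma_finite_lebesgue)

interpretation lebesgue_pair: pair_sigma_finite "lebesgue :: 'a::euclidean_space measure" "lebesgue :: 'a measure"
  ..

lemma (in pair_sigma_finite) integrable_pair_mult:
  fixes f g :: "_ \<Rightarrow> complex"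
  assumes "integrable M1 f" "integrable M2 g"
  shows "integrable (M1 \<Otimes>\<^sub>M M2) (\<lambda>p. f (fst p) * g (snd p))"
proof (rule Fubini_integrable)
  have [measurable]: "f \<in> borel_measurable M1" "g \<in> borel_measurable M2"
    using assms by auto
  show "(\<lambda>p. f (fst p) * g (snd p)) \<in> borel_measurable (M1 \<Otimes>\<^sub>M M2)"
    by measurable
  show "integrable M1 (\<lambda>x. LINT y|M2. norm (f (fst (x, y)) * g (snd (x, y))))"
    using assms by (simp add: norm_mult)
  show "AE x in M1. integrable M2 (\<lambda>y. f (fst (x, y)) * g (snd (x, y)))"
    using assms by simp
qed

lemma (in pair_sigma_finite) integral_pair_mult:
  fixes f g :: "_ \<Rightarrow> complex"
  assumes "integrable M1 f" "integrable M2 g"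
  shows "(LINT p|(M1 \<Otimes>\<^sub>M M2). f (fst p) * g (snd p)) = (LINT x|M1. f x) * (LINT y|M2. g y)"
  using integral_fst'[OF integrable_pair_mult[OF assms]] by simp

abbreviation fourier_kernel :: "'a::euclidean_space \<Rightarrow> 'a \<Rightarrow> complex" where
  "fourier_kernel x \<xi> \<equiv> exp (- (\<i> * complex_of_real (x \<bullet> \<xi>)))"

lemma norm_fourier_kernel: "cmod (fourier_kernel x \<xi>) = 1"
  using norm_exp_i_times[of "- (x \<bullet> \<xi>)"] by simp

lemma integrable_fourier_kernel:
  fixes f :: "'a::euclidean_space \<Rightarrow> complex"
  assumes "integrable lebesgue f"
  shows "integrable lebesgue (\<lambda>x. f x * fourier_kernel x \<xi>)"
proof -
  have [measurable]: "f \<in> borel_measurable lebesgue"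
    using assms by auto
  show ?thesis
    by (rule Bochner_Integration.integrable_bound[OF assms])
       (measurable, simp add: norm_mult norm_fourier_kernel)
qed

lemma fourier_int_measurable:
  fixes f :: "'a::euclidean_space \<Rightarrow> complex"
  assumes "f \<in> borel_measurable lebesgue"
  shows "fourier_int f \<in> borel_measurable lebesgue"
proof -
  note [measurable] = assms
  show ?thesis
    unfolding fourier_int_def by measurable
qed

lemma norm_fourier_int_le:
  fixes f :: "'a::euclidean_space \<Rightarrow> complex"
  shows "cmod (fourier_int f \<xi>) \<le> (LINT x|lebesgue. cmod (f x))"
proof -
  have "cmod (fourier_int f \<xi>) \<le> (LINT x|lebesgue. cmod (f x * fourier_kernel x \<xi>))"
    unfolding fourier_int_def by (rule integral_norm_bound)
  then show ?thesis
    by (simp add: norm_mult norm_fourier_kernel)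
qed

text \<open>Fubini applied to f(x) g(\<xi>) times the kernel. The kernel has modulus 1 and is
  symmetric in x and \<xi>, so each order of integration produces a Fourier integral.\<close>

lemma fourier_int_multiplication_formula:
  fixes f g :: "'a::euclidean_space \<Rightarrow> complex"
  assumes "integrable lebesgue f" "integrable lebesgue g"
  shows "(LINT \<xi>|lebesgue. fourier_int f \<xi> * g \<xi>) = (LINT x|lebesgue. f x * fourier_int g x)"
proof -
  have [measurable]: "f \<in> borel_measurable lebesgue" "g \<in> borel_measurable lebesgue"
    using assms by auto
  have "integrable (lebesgue \<Otimes>\<^sub>M lebesgue) (\<lambda>p. f (fst p) * g (snd p) * fourier_kernel (fst p) (snd p))"
    by (rule Bochner_Integration.integrable_bound[OF lebesgue_pair.integrable_pair_mult[OF assms]])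
       (measurable, simp add: norm_mult norm_fourier_kernel)
  then have "integrable (lebesgue \<Otimes>\<^sub>M lebesgue) (\<lambda>(x, \<xi>). f x * g \<xi> * fourier_kernel x \<xi>)"
    by (simp add: case_prod_beta')
  note Fubini = lebesgue_pair.Fubini_integral[OF this]
  have "fourier_int f \<xi> * g \<xi> = (LINT x|lebesgue. f x * g \<xi> * fourier_kernel x \<xi>)" for \<xi>
    unfolding fourier_int_def integral_mult_left_zero[symmetric] by (simp only: mult_ac)
  moreover have "f x * fourier_int g x = (LINT \<xi>|lebesgue. f x * g \<xi> * fourier_kernel x \<xi>)" for x
    unfolding fourier_int_def integral_mult_right_zero[symmetric] by (simp only: mult_ac inner_commute)
  ultimately show ?thesis
    using Fubini by simp
qed

text \<open>The Fourier transform of \<open>gauss s\<close>, by \<open>gauss_fourier\<close>. For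
  every s > 0 its total mass is (2 pi)^n, and it concentrates at 0 as s \<rightarrow> 0: an
  approximate identity up to the constant (2 pi)^n, which is where the Plancherel constant comes
  from.\<close>

definition heat_kernel :: "real \<Rightarrow> 'a::euclidean_space \<Rightarrow> real" where
  "heat_kernel s z = (sqrt (2 * pi) / s) ^ DIM('a) * gauss (1/s) z"

lemma heat_kernel_measurable [measurable]: "heat_kernel s \<in> borel_measurable borel"
  unfolding heat_kernel_def by measurable

lemma heat_kernel_nonneg: "s > 0 \<Longrightarrow> 0 \<le> heat_kernel s z"
  by (simp add: heat_kernel_def gauss_nonneg)

lemma heat_kernel_minus: "heat_kernel s (x - y) = heat_kernel s (y - x)"
  by (simp add: heat_kernel_def gauss_def norm_minus_commute)

lemma gauss_fourier_lebesgue: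
  fixes z :: "'a::euclidean_space"
  assumes "s > 0"
  shows "integrable lebesgue (\<lambda>x. complex_of_real (gauss s x) * exp (\<i> * of_real (z \<bullet> x)))"
    and "(LINT x|lebesgue. complex_of_real (gauss s x) * exp (\<i> * of_real (z \<bullet> x)))
      = of_real (heat_kernel s z)"
  using gauss_fourier[OF assms, of z]
  by (simp_all add: integrable_completion integral_completion heat_kernel_def)

text \<open>The substitution y = x + s w moves the dependence on s from the kernel into the argument
  of f and leaves a fixed Gaussian weight, so that s \<rightarrow> 0 becomes a pointwise
  limit.\<close>

lemma nn_integral_heat_kernel:
  fixes x :: "'a::euclidean_space"
  assumes "s > 0" and [measurable]: "f \<in> borel_measurable borel"
  shows "(\<integral>\<^sup>+y. f y * ennreal (heat_kernel s (x - y)) \<partial>lebesgue)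
    = (\<integral>\<^sup>+w. f (x + s *\<^sub>R w) * ennreal (sqrt (2 * pi) ^ DIM('a) * gauss 1 w) \<partial>lborel)"
proof -
  \<comment> \<open>The Jacobian s^n of the substitution cancels the factor s^(-n) of the
    kernel.\<close>
  have e: "s ^ DIM('a) * heat_kernel s (x - (x + s *\<^sub>R w)) = sqrt (2 * pi) ^ DIM('a) * gauss 1 w" for w :: 'a
    using assms(1) by (simp add: heat_kernel_def gauss_def power_divide)
  have e': "ennreal (s ^ DIM('a)) * ennreal (heat_kernel s (x - (x + s *\<^sub>R w)))
    = ennreal (sqrt (2 * pi) ^ DIM('a) * gauss 1 w)" for w :: 'a
    using assms(1) by (simp only: e[symmetric] ennreal_mult heat_kernel_nonneg zero_le_power less_imp_le)
  have "(\<integral>\<^sup>+y. f y * ennreal (heat_kernel s (x - y)) \<partial>lebesgue)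
    = ennreal (s ^ DIM('a)) * (\<integral>\<^sup>+w. f (x + s *\<^sub>R w) * ennreal (heat_kernel s (x - (x + s *\<^sub>R w))) \<partial>lborel)"
    using assms(1) unfolding nn_integral_completion
    by (subst nn_integral_lborel_affine[of _ s x]) auto
  also have "\<dots> = (\<integral>\<^sup>+w. f (x + s *\<^sub>R w) * (ennreal (s ^ DIM('a)) * ennreal (heat_kernel s (x - (x + s *\<^sub>R w)))) \<partial>lborel)"
    by (subst nn_integral_cmult[symmetric]) (simp_all add: mult.left_commute del: add_diff_cancel_left' diff_add_cancel)
  also have "\<dots> = (\<integral>\<^sup>+w. f (x + s *\<^sub>R w) * ennreal (sqrt (2 * pi) ^ DIM('a) * gauss 1 w) \<partial>lborel)"
    unfolding e' ..
  finally show ?thesis .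
qed

lemma gauss_1_mass:
  "(\<integral>\<^sup>+w. ennreal (sqrt (2 * pi) ^ DIM('a) * gauss 1 (w::'a::euclidean_space)) \<partial>lborel) = ennreal ((2 * pi) ^ DIM('a))"
proof -
  have "(\<integral>\<^sup>+w. ennreal (sqrt (2 * pi) ^ DIM('a) * gauss 1 (w::'a)) \<partial>lborel)
    = ennreal (sqrt (2 * pi) ^ DIM('a)) * ennreal (sqrt (2 * pi) ^ DIM('a))"
    using gauss_nn_integral[of 1, where 'a = 'a]
    by (simp add: ennreal_mult gauss_nonneg nn_integral_cmult)
  also have "\<dots> = ennreal ((2 * pi) ^ DIM('a))"
  proof -
    have "sqrt (2 * pi) ^ DIM('a) * sqrt (2 * pi) ^ DIM('a) = (sqrt (2 * pi) * sqrt (2 * pi)) ^ DIM('a)"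
      by (rule power_mult_distrib[symmetric])
    also have "sqrt (2 * pi) * sqrt (2 * pi) = 2 * pi"
      by (rule real_sqrt_mult_self[THEN trans]) simp
    finally show ?thesis
      by (simp only: ennreal_mult[symmetric] zero_le_power real_sqrt_ge_zero pi_ge_zero mult_nonneg_nonneg zero_le_numeral)
  qed
  finally show ?thesis .
qed

lemma nn_integral_heat_kernel_mass:
  fixes x :: "'a::euclidean_space"
  assumes "s > 0"
  shows "(\<integral>\<^sup>+y. ennreal (heat_kernel s (x - y)) \<partial>lebesgue) = ennreal ((2 * pi) ^ DIM('a))"
  using nn_integral_heat_kernel[OF assms, of "\<lambda>_. 1" x] by (simp add: gauss_1_mass)

section \<open>Gaussian regularisation and the upper Plancherel bound\<close>

lemma fourier_int_gauss:
  fixes f :: "'a::euclidean_space \<Rightarrow> complex"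
  assumes f: "integrable lebesgue f" and s: "s > 0"
  shows "integrable lebesgue (\<lambda>\<xi>. (cmod (fourier_int f \<xi>))\<^sup>2 * gauss s \<xi>)"
    and "complex_of_real (LINT \<xi>|lebesgue. (cmod (fourier_int f \<xi>))\<^sup>2 * gauss s \<xi>)
      = (LINT p|(lebesgue \<Otimes>\<^sub>M lebesgue). f (fst p) * cnj (f (snd p)) * of_real (heat_kernel s (fst p - snd p)))"
proof -
  let ?P = "lebesgue \<Otimes>\<^sub>M lebesgue :: ('a \<times> 'a) measure"
  have fm [measurable]: "f \<in> borel_measurable lebesgue"
    using f by auto
  have [measurable]: "fourier_int f \<in> borel_measurable lebesgue"
    by (rule fourier_int_measurable[OF fm])
  have gi: "integrable lebesgue (\<lambda>\<xi>::'a. complex_of_real (gauss s \<xi>))"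
    using gauss_fourier_lebesgue(1)[OF s, of 0] by simp
  show "integrable lebesgue (\<lambda>\<xi>. (cmod (fourier_int f \<xi>))\<^sup>2 * gauss s \<xi>)"
  proof (rule integrable_real_bound)
    show "integrable lebesgue (\<lambda>\<xi>::'a. (LINT x|lebesgue. cmod (f x))\<^sup>2 * cmod (complex_of_real (gauss s \<xi>)))"
      by (intro integrable_mult_right integrable_norm gi)
    show "norm ((cmod (fourier_int f \<xi>))\<^sup>2 * gauss s \<xi>) \<le> (LINT x|lebesgue. cmod (f x))\<^sup>2 * cmod (complex_of_real (gauss s \<xi>))" for \<xi>
      using norm_fourier_int_le[of f \<xi>] by (auto simp: abs_mult intro!: mult_right_mono power_mono)
  qed measurable
  interpret Q: sigma_finite_measure ?P
    ..
  interpret R: pair_sigma_finite ?P "lebesgue :: 'a measure" ..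
  let ?h = "\<lambda>p. f (fst p) * cnj (f (snd p))"
  have cf: "integrable lebesgue (\<lambda>x. cnj (f x))"
    using f by simp
  have hi: "integrable ?P ?h"
    by (rule lebesgue_pair.integrable_pair_mult[OF f cf])
  have hm [measurable]: "?h \<in> borel_measurable ?P"
    using hi by auto
  \<comment> \<open>|F f(\<xi>)|^2 is the double integral of f(x) cnj (f y) times this combined
    phase, so the integral over \<xi> against the Gaussian is a Gaussian transform at z = y -
    x.\<close>
  let ?E = "\<lambda>p \<xi>. exp (\<i> * complex_of_real ((snd p - fst p) \<bullet> \<xi>))"
  have E: "fourier_kernel x \<xi> * cnj (fourier_kernel y \<xi>) = ?E (x, y) \<xi>" for x y \<xi> :: 'a
    by (simp add: exp_cnj exp_add[symmetric] inner_diff_left algebra_simps)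
  have sq: "complex_of_real ((cmod (fourier_int f \<xi>))\<^sup>2) = (LINT p|?P. ?h p * ?E p \<xi>)" for \<xi>
  proof -
    have "complex_of_real ((cmod (fourier_int f \<xi>))\<^sup>2) = fourier_int f \<xi> * cnj (fourier_int f \<xi>)"
      by (rule complex_norm_square)
    also have "\<dots> = (LINT x|lebesgue. f x * fourier_kernel x \<xi>) * (LINT y|lebesgue. cnj (f y * fourier_kernel y \<xi>))"
      unfolding fourier_int_def by (simp del: complex_cnj_mult)
    also have "\<dots> = (LINT p|?P. (f (fst p) * fourier_kernel (fst p) \<xi>) * cnj (f (snd p) * fourier_kernel (snd p) \<xi>))"
      by (rule lebesgue_pair.integral_pair_mult[symmetric])
         (use integrable_fourier_kernel[OF f] in \<open>simp_all del: complex_cnj_mult\<close>)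
    also have "\<dots> = (LINT p|?P. ?h p * (fourier_kernel (fst p) \<xi> * cnj (fourier_kernel (snd p) \<xi>)))"
      by (simp add: mult_ac)
    also have "\<dots> = (LINT p|?P. ?h p * ?E p \<xi>)"
      unfolding E by simp
    finally show ?thesis .
  qed
  have Hi0: "integrable (?P \<Otimes>\<^sub>M lebesgue) (\<lambda>q :: ('a \<times> 'a) \<times> 'a. ?h (fst q) * complex_of_real (gauss s (snd q)))"
    using R.integrable_pair_mult[OF hi gi] by simp
  have Em [measurable]: "(\<lambda>q. ?E (fst q) (snd q)) \<in> borel_measurable (?P \<Otimes>\<^sub>M lebesgue)"
    by measurable
  have "integrable (?P \<Otimes>\<^sub>M lebesgue) (\<lambda>q :: ('a \<times> 'a) \<times> 'a. ?h (fst q) * complex_of_real (gauss s (snd q)) * ?E (fst q) (snd q))"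
    by (rule Bochner_Integration.integrable_bound[OF Hi0])
       (measurable, simp add: norm_mult)
  then have H: "integrable (?P \<Otimes>\<^sub>M lebesgue) (\<lambda>(p, \<xi>). ?h p * complex_of_real (gauss s \<xi>) * ?E p \<xi>)"
    by (simp add: case_prod_beta')
  have "complex_of_real (LINT \<xi>|lebesgue. (cmod (fourier_int f \<xi>))\<^sup>2 * gauss s \<xi>)
    = (LINT \<xi>|lebesgue. complex_of_real ((cmod (fourier_int f \<xi>))\<^sup>2) * complex_of_real (gauss s \<xi>))"
    by (subst integral_complex_of_real[symmetric]) simp
  also have "\<dots> = (LINT \<xi>|lebesgue. (LINT p|?P. ?h p * ?E p \<xi>) * complex_of_real (gauss s \<xi>))"
    unfolding sq ..
  also have "\<dots> = (LINT \<xi>|lebesgue. LINT p|?P. ?h p * complex_of_real (gauss s \<xi>) * ?E p \<xi>)"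
    by (subst integral_mult_left_zero[symmetric]) (simp add: mult_ac)
  also have "\<dots> = (LINT p|?P. LINT \<xi>|lebesgue. ?h p * complex_of_real (gauss s \<xi>) * ?E p \<xi>)"
    by (rule R.Fubini_integral[OF H])
  also have "\<dots> = (LINT p|?P. ?h p * (LINT \<xi>|lebesgue. complex_of_real (gauss s \<xi>) * ?E p \<xi>))"
    by (subst integral_mult_right_zero[symmetric]) (simp only: mult.assoc)
  also have "\<dots> = (LINT p|?P. ?h p * of_real (heat_kernel s (snd p - fst p)))"
    unfolding gauss_fourier_lebesgue(2)[OF s] ..
  finally show "complex_of_real (LINT \<xi>|lebesgue. (cmod (fourier_int f \<xi>))\<^sup>2 * gauss s \<xi>)
      = (LINT p|?P. ?h p * of_real (heat_kernel s (fst p - snd p)))"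
    unfolding heat_kernel_minus[of s "fst _"] .
qed

lemma fourier_int_gauss_le:
  fixes f :: "'a::euclidean_space \<Rightarrow> complex"
  assumes f: "integrable lebesgue f" and s: "s > 0"
  shows "(\<integral>\<^sup>+\<xi>. ennreal ((cmod (fourier_int f \<xi>))\<^sup>2 * gauss s \<xi>) \<partial>lebesgue)
    \<le> ennreal ((2 * pi) ^ DIM('a)) * (\<integral>\<^sup>+x. ennreal ((cmod (f x))\<^sup>2) \<partial>lebesgue)"
proof -
  let ?P = "lebesgue \<Otimes>\<^sub>M lebesgue :: ('a \<times> 'a) measure"
  let ?H = "\<lambda>p. f (fst p) * cnj (f (snd p)) * of_real (heat_kernel s (fst p - snd p))"
  \<comment> \<open>The halves come from |f(x) f(y)| \<le> |f(x)|^2 / 2 + |f(y)|^2 / 2. The kernel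
    is even and has the same mass in either variable, so the two terms contribute equally and add up
    to the full constant.\<close>
  let ?f2 = "\<lambda>x. ennreal ((cmod (f x))\<^sup>2 / 2)"
  have [measurable]: "f \<in> borel_measurable lebesgue"
    using f by auto
  let ?I = "LINT \<xi>|lebesgue. (cmod (fourier_int f \<xi>))\<^sup>2 * gauss s \<xi>"
  have I: "(\<integral>\<^sup>+\<xi>. ennreal ((cmod (fourier_int f \<xi>))\<^sup>2 * gauss s \<xi>) \<partial>lebesgue) = ennreal ?I"
    by (rule nn_integral_eq_integral[OF fourier_int_gauss(1)[OF f s]]) (simp add: gauss_nonneg)
  have "0 \<le> ?I"
    by (simp add: integral_nonneg_AE gauss_nonneg)
  then have "?I = cmod (complex_of_real ?I)"
    by simp
  then have "ennreal ?I = ennreal (cmod (LINT p|?P. ?H p))"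
    unfolding fourier_int_gauss(2)[OF f s] by simp
  also have "\<dots> \<le> (\<integral>\<^sup>+p. ennreal (cmod (?H p)) \<partial>?P)"
  \<comment> \<open>The Bochner integral is 0 by convention for a non-integrable function, so the
    norm bound holds in both cases.\<close>
  proof (cases "integrable ?P ?H")
    case True
    then show ?thesis by (rule integral_norm_bound_ennreal)
  next
    case False
    then have "(LINT p|?P. ?H p) = 0" by (rule not_integrable_integral_eq)
    then show ?thesis by (simp only: norm_zero ennreal_0 zero_le)
  qed
  also have "\<dots> \<le> (\<integral>\<^sup>+p. ?f2 (fst p) * ennreal (heat_kernel s (fst p - snd p)) + ?f2 (snd p) * ennreal (heat_kernel s (fst p - snd p)) \<partial>?P)"
  proof (rule nn_integral_mono)
    fix p :: "'a \<times> 'a"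
    have "cmod (f (fst p)) * cmod (f (snd p)) \<le> (cmod (f (fst p)))\<^sup>2 / 2 + (cmod (f (snd p)))\<^sup>2 / 2"
      using sum_squares_bound[of "cmod (f (fst p))" "cmod (f (snd p))"] by simp
    then have "cmod (f (fst p)) * cmod (f (snd p)) * heat_kernel s (fst p - snd p)
       \<le> ((cmod (f (fst p)))\<^sup>2 / 2 + (cmod (f (snd p)))\<^sup>2 / 2) * heat_kernel s (fst p - snd p)"
      by (rule mult_right_mono) (rule heat_kernel_nonneg[OF s])
    then have "ennreal (cmod (?H p)) \<le> ennreal (((cmod (f (fst p)))\<^sup>2 / 2 + (cmod (f (snd p)))\<^sup>2 / 2) * heat_kernel s (fst p - snd p))"
      by (intro ennreal_leI) (simp add: norm_mult heat_kernel_nonneg[OF s])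
    also have "\<dots> = ?f2 (fst p) * ennreal (heat_kernel s (fst p - snd p)) + ?f2 (snd p) * ennreal (heat_kernel s (fst p - snd p))"
    proof -
      have nn: "0 \<le> (cmod z)\<^sup>2 / 2" for z
        by simp
      show ?thesis
        by (simp only: ennreal_mult ennreal_plus heat_kernel_nonneg[OF s] distrib_right nn add_nonneg_nonneg mult_nonneg_nonneg)
    qed
    finally show "ennreal (cmod (?H p)) \<le> \<dots>" .
  qed
  also have "\<dots> = (\<integral>\<^sup>+p. ?f2 (fst p) * ennreal (heat_kernel s (fst p - snd p)) \<partial>?P)
     + (\<integral>\<^sup>+p. ?f2 (snd p) * ennreal (heat_kernel s (fst p - snd p)) \<partial>?P)"
    by (rule nn_integral_add) measurable
  also have "(\<integral>\<^sup>+p. ?f2 (fst p) * ennreal (heat_kernel s (fst p - snd p)) \<partial>?P)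
     = (\<integral>\<^sup>+x. \<integral>\<^sup>+y. ?f2 x * ennreal (heat_kernel s (x - y)) \<partial>lebesgue \<partial>lebesgue)"
    by (subst lebesgue.nn_integral_fst[symmetric]) simp_all
  also have "\<dots> = (\<integral>\<^sup>+x. ?f2 x * ennreal ((2 * pi) ^ DIM('a)) \<partial>lebesgue)"
    by (subst nn_integral_cmult) (simp_all add: nn_integral_heat_kernel_mass[OF s])
  also have "(\<integral>\<^sup>+p. ?f2 (snd p) * ennreal (heat_kernel s (fst p - snd p)) \<partial>?P)
     = (\<integral>\<^sup>+y. \<integral>\<^sup>+x. ?f2 y * ennreal (heat_kernel s (y - x)) \<partial>lebesgue \<partial>lebesgue)"
    by (subst lebesgue_pair.nn_integral_snd[symmetric]) (simp_all add: heat_kernel_minus)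
  also have "\<dots> = (\<integral>\<^sup>+x. ?f2 x * ennreal ((2 * pi) ^ DIM('a)) \<partial>lebesgue)"
    by (subst nn_integral_cmult) (simp_all add: nn_integral_heat_kernel_mass[OF s])
  also have "(\<integral>\<^sup>+x. ?f2 x * ennreal ((2 * pi) ^ DIM('a)) \<partial>lebesgue) + (\<integral>\<^sup>+x. ?f2 x * ennreal ((2 * pi) ^ DIM('a)) \<partial>lebesgue)
    = (\<integral>\<^sup>+x. ?f2 x * ennreal ((2 * pi) ^ DIM('a)) + ?f2 x * ennreal ((2 * pi) ^ DIM('a)) \<partial>lebesgue)"
    by (rule nn_integral_add[symmetric]) measurable
  also have "\<dots> = (\<integral>\<^sup>+x. ennreal ((2 * pi) ^ DIM('a)) * ennreal ((cmod (f x))\<^sup>2) \<partial>lebesgue)"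
  proof (rule nn_integral_cong)
    fix x :: 'a
    have half: "?f2 x + ?f2 x = ennreal ((cmod (f x))\<^sup>2)"
      by (subst ennreal_plus[symmetric]) simp_all
    show "?f2 x * ennreal ((2 * pi) ^ DIM('a)) + ?f2 x * ennreal ((2 * pi) ^ DIM('a))
      = ennreal ((2 * pi) ^ DIM('a)) * ennreal ((cmod (f x))\<^sup>2)"
      unfolding distrib_right[symmetric] half by (rule mult.commute)
  qed
  also have "\<dots> = ennreal ((2 * pi) ^ DIM('a)) * (\<integral>\<^sup>+x. ennreal ((cmod (f x))\<^sup>2) \<partial>lebesgue)"
    by (rule nn_integral_cmult) measurable
  finally show ?thesis
    unfolding I .
qed

lemma gauss_tendsto_1: "(\<lambda>n. gauss (inverse (real (Suc n))) x) \<longlonglongrightarrow> 1"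
proof -
  have "(\<lambda>n. exp (- (inverse (real (Suc n)) * norm x)\<^sup>2 / 2)) \<longlonglongrightarrow> exp (- (0 * norm x)\<^sup>2 / 2)"
    by (intro tendsto_intros LIMSEQ_inverse_real_of_nat) auto
  then show ?thesis
    by (simp add: gauss_def)
qed

text \<open>The regularised bounds are uniform in s, so Fatou's lemma along s = 1 / (n + 1) removes
  the Gaussian. The right-hand side may be infinite here.\<close>

lemma fourier_int_contraction:
  fixes f :: "'a::euclidean_space \<Rightarrow> complex"
  assumes f: "integrable lebesgue f"
  shows "(\<integral>\<^sup>+\<xi>. ennreal ((cmod (fourier_int f \<xi>))\<^sup>2) \<partial>lebesgue)
    \<le> ennreal ((2 * pi) ^ DIM('a)) * (\<integral>\<^sup>+x. ennreal ((cmod (f x))\<^sup>2) \<partial>lebesgue)"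
proof -
  have [measurable]: "fourier_int f \<in> borel_measurable lebesgue"
    using f by (intro fourier_int_measurable) auto
  let ?g = "\<lambda>n \<xi>. ennreal ((cmod (fourier_int f \<xi>))\<^sup>2 * gauss (inverse (real (Suc n))) \<xi>)"
  have "ennreal ((cmod (fourier_int f \<xi>))\<^sup>2) = liminf (\<lambda>n. ?g n \<xi>)" for \<xi>
  proof -
    have "(\<lambda>n. ?g n \<xi>) \<longlonglongrightarrow> ennreal ((cmod (fourier_int f \<xi>))\<^sup>2 * 1)"
      by (intro tendsto_ennrealI tendsto_mult tendsto_const gauss_tendsto_1)
    from lim_imp_Liminf[OF _ this] show ?thesis
      by simp
  qed
  then have "(\<integral>\<^sup>+\<xi>. ennreal ((cmod (fourier_int f \<xi>))\<^sup>2) \<partial>lebesgue) = (\<integral>\<^sup>+\<xi>. liminf (\<lambda>n. ?g n \<xi>) \<partial>lebesgue)"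
    by simp
  also have "\<dots> \<le> liminf (\<lambda>n. \<integral>\<^sup>+\<xi>. ?g n \<xi> \<partial>lebesgue)"
    by (rule nn_integral_liminf) measurable
  also have "\<dots> \<le> limsup (\<lambda>n. \<integral>\<^sup>+\<xi>. ?g n \<xi> \<partial>lebesgue)"
    by (rule Liminf_le_Limsup) simp
  also have "\<dots> \<le> ennreal ((2 * pi) ^ DIM('a)) * (\<integral>\<^sup>+x. ennreal ((cmod (f x))\<^sup>2) \<partial>lebesgue)"
    by (intro Limsup_bounded always_eventually allI fourier_int_gauss_le f) simp
  finally show ?thesis .
qed

section \<open>The lower Plancherel bound for indicators of boxes\<close>

lemma integrable_indicator_box:
  "integrable lebesgue (indicator (box a b) :: 'a::euclidean_space \<Rightarrow> real)"
  "integrable lebesgue (indicator (box a b) :: 'a::euclidean_space \<Rightarrow> complex)"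
proof -
  show r: "integrable lebesgue (indicator (box a b) :: 'a \<Rightarrow> real)"
    using emeasure_lborel_box_finite[of a b] by (intro integrable_real_indicator) simp_all
  have "(indicator (box a b) :: 'a \<Rightarrow> complex) = (\<lambda>x. complex_of_real (indicator (box a b) x))"
    by (auto simp: indicator_def)
  with r show "integrable lebesgue (indicator (box a b) :: 'a \<Rightarrow> complex)"
    by (simp add: complex_of_real_integrable_eq)
qed

text \<open>For a nonnegative f the regularised identity becomes one between nonnegative integrals.
  After the substitution, s occurs only inside an indicator, the form to which Fatou's lemma applies
  in \<open>fourier_int_box_ge\<close>.\<close>

lemma nn_integral_indicator_heat_kernel:
  fixes a b :: "'a::euclidean_space"
  defines "U \<equiv> box a b"
  assumes s: "s > 0"
  shows "(\<integral>\<^sup>+\<xi>. ennreal ((cmod (fourier_int (indicator U) \<xi>))\<^sup>2 * gauss s \<xi>) \<partial>lebesgue)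
    = (\<integral>\<^sup>+p. indicator U (fst p) * (indicator U (fst p + s *\<^sub>R snd p) *
        ennreal (sqrt (2 * pi) ^ DIM('a) * gauss 1 (snd p))) \<partial>(lborel \<Otimes>\<^sub>M lborel))"
proof -
  let ?P = "lebesgue \<Otimes>\<^sub>M lebesgue :: ('a \<times> 'a) measure"
  let ?f = "indicator U :: 'a \<Rightarrow> complex"
  let ?h = "\<lambda>p. indicator U (fst p) * (indicator U (snd p) * heat_kernel s (fst p - snd p)) :: real"
  have [measurable]: "U \<in> sets borel" "U \<in> sets lebesgue"
    by (simp_all add: U_def)
  have f: "integrable lebesgue ?f"
    unfolding U_def by (rule integrable_indicator_box)
  let ?I = "LINT \<xi>|lebesgue. (cmod (fourier_int ?f \<xi>))\<^sup>2 * gauss s \<xi>"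
  have I: "(\<integral>\<^sup>+\<xi>. ennreal ((cmod (fourier_int ?f \<xi>))\<^sup>2 * gauss s \<xi>) \<partial>lebesgue) = ennreal ?I"
    by (rule nn_integral_eq_integral[OF fourier_int_gauss(1)[OF f s]]) (simp add: gauss_nonneg)
  \<comment> \<open>A bounded kernel times an integrable product is integrable, which allows passing
    from the Bochner integral to the nonnegative one.\<close>
  have kb: "heat_kernel s z \<le> (sqrt (2 * pi) / s) ^ DIM('a)" for z :: 'a
    using s unfolding heat_kernel_def by (intro mult_left_le gauss_le_1) simp
  have hi: "integrable ?P ?h"
  proof (rule integrable_real_bound)
    have "integrable ?P (\<lambda>p. cmod (?f (fst p) * ?f (snd p)))"
      by (intro integrable_norm lebesgue_pair.integrable_pair_mult f)
    then show "integrable ?P (\<lambda>p. (sqrt (2 * pi) / s) ^ DIM('a) * cmod (?f (fst p) * ?f (snd p)))"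
      by (rule integrable_mult_right)
    show "norm (?h p) \<le> (sqrt (2 * pi) / s) ^ DIM('a) * cmod (?f (fst p) * ?f (snd p))" for p
      using kb[of "fst p - snd p"] heat_kernel_nonneg[OF s, of "fst p - snd p"] by (auto simp: indicator_def)
  qed measurable
  have "complex_of_real ?I = (LINT p|?P. complex_of_real (?h p))"
    unfolding fourier_int_gauss(2)[OF f s]
    by (intro Bochner_Integration.integral_cong) (auto simp: indicator_def)
  also have "\<dots> = complex_of_real (LINT p|?P. ?h p)"
    by (rule integral_complex_of_real)
  finally have "?I = (LINT p|?P. ?h p)"
    by (rule of_real_eq_iff[THEN iffD1])
  then have "ennreal ?I = (\<integral>\<^sup>+p. ennreal (?h p) \<partial>?P)"
    by (subst nn_integral_eq_integral[OF hi]) (simp_all add: heat_kernel_nonneg[OF s])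
  also have "\<dots> = (\<integral>\<^sup>+p. indicator U (fst p) * (indicator U (snd p) * ennreal (heat_kernel s (fst p - snd p))) \<partial>?P)"
    by (intro nn_integral_cong) (simp add: indicator_def)
  also have "\<dots> = (\<integral>\<^sup>+x. \<integral>\<^sup>+y. indicator U x * (indicator U y * ennreal (heat_kernel s (x - y))) \<partial>lebesgue \<partial>lebesgue)"
    by (subst lebesgue.nn_integral_fst[symmetric]) simp_all
  also have "\<dots> = (\<integral>\<^sup>+x. indicator U x * (\<integral>\<^sup>+y. indicator U y * ennreal (heat_kernel s (x - y)) \<partial>lebesgue) \<partial>lebesgue)"
    by (subst nn_integral_cmult) simp_all
  also have "\<dots> = (\<integral>\<^sup>+x. indicator U x * (\<integral>\<^sup>+w. indicator U (x + s *\<^sub>R w) * ennreal (sqrt (2 * pi) ^ DIM('a) * gauss 1 w) \<partial>lborel) \<partial>lborel)"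
    by (subst nn_integral_heat_kernel[OF s]) (simp_all add: nn_integral_completion)
  also have "\<dots> = (\<integral>\<^sup>+x. \<integral>\<^sup>+w. indicator U x * (indicator U (x + s *\<^sub>R w) * ennreal (sqrt (2 * pi) ^ DIM('a) * gauss 1 w)) \<partial>lborel \<partial>lborel)"
    by (subst nn_integral_cmult) simp_all
  also have "\<dots> = (\<integral>\<^sup>+p. indicator U (fst p) * (indicator U (fst p + s *\<^sub>R snd p) *
        ennreal (sqrt (2 * pi) ^ DIM('a) * gauss 1 (snd p))) \<partial>(lborel \<Otimes>\<^sub>M lborel))"
    by (subst lborel.nn_integral_fst[symmetric]) simp_all
  finally show ?thesis
    unfolding I .
qed

text \<open>Since U is open, x in U implies x + s w in U for all small s, so the integrands converge
  pointwise to the product of the indicator and the fixed Gaussian weight, whose integral is the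
  left-hand side.\<close>

lemma fourier_int_box_ge:
  fixes a b :: "'a::euclidean_space"
  defines "U \<equiv> box a b"
  shows "ennreal ((2 * pi) ^ DIM('a)) * emeasure lborel U
    \<le> (\<integral>\<^sup>+\<xi>. ennreal ((cmod (fourier_int (indicator U) \<xi>))\<^sup>2) \<partial>lebesgue)"
proof -
  have [measurable]: "U \<in> sets borel"
    by (simp add: U_def)
  have U: "open U"
    by (simp add: U_def open_box)
  let ?c = "\<lambda>w. ennreal (sqrt (2 * pi) ^ DIM('a) * gauss 1 (w::'a))"
  let ?s = "\<lambda>n. inverse (real (Suc n))"
  let ?g = "\<lambda>n p. indicator U (fst p) * (indicator U (fst p + ?s n *\<^sub>R snd p) * ?c (snd p))"
  have lim: "indicator U (fst p) * ?c (snd p) = liminf (\<lambda>n. ?g n p)" for p :: "'a \<times> 'a"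
  proof (cases "fst p \<in> U")
    case True
    have "(\<lambda>n. fst p + ?s n *\<^sub>R snd p) \<longlonglongrightarrow> fst p + 0 *\<^sub>R snd p"
      by (intro tendsto_intros LIMSEQ_inverse_real_of_nat)
    then have "\<forall>\<^sub>F n in sequentially. fst p + ?s n *\<^sub>R snd p \<in> U"
      using U True by (intro topological_tendstoD) auto
    then have "\<forall>\<^sub>F n in sequentially. ?g n p = ?c (snd p)"
      by eventually_elim (simp add: True)
    from lim_imp_Liminf[OF _ tendsto_eventually[OF this]] show ?thesis
      by (simp add: True)
  next
    case False
    then show ?thesis
      by (simp add: Liminf_const)
  qed
  have "ennreal ((2 * pi) ^ DIM('a)) * emeasure lborel U = (\<integral>\<^sup>+x. indicator U x * (\<integral>\<^sup>+w. ?c w \<partial>lborel) \<partial>lborel)"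
    unfolding gauss_1_mass by (simp add: nn_integral_multc mult.commute[of _ "emeasure lborel U"])
  also have "\<dots> = (\<integral>\<^sup>+x. \<integral>\<^sup>+w. indicator U x * ?c w \<partial>lborel \<partial>lborel)"
    by (subst nn_integral_cmult) simp_all
  also have "\<dots> = (\<integral>\<^sup>+p. indicator U (fst p) * ?c (snd p) \<partial>(lborel \<Otimes>\<^sub>M lborel))"
    by (subst lborel.nn_integral_fst[symmetric]) simp_all
  also have "\<dots> = (\<integral>\<^sup>+p. liminf (\<lambda>n. ?g n p) \<partial>(lborel \<Otimes>\<^sub>M lborel))"
    unfolding lim ..
  also have "\<dots> \<le> liminf (\<lambda>n. \<integral>\<^sup>+p. ?g n p \<partial>(lborel \<Otimes>\<^sub>M lborel))"
    by (rule nn_integral_liminf) measurable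
  also have "\<dots> \<le> limsup (\<lambda>n. \<integral>\<^sup>+p. ?g n p \<partial>(lborel \<Otimes>\<^sub>M lborel))"
    by (rule Liminf_le_Limsup) simp
  also have "\<dots> \<le> (\<integral>\<^sup>+\<xi>. ennreal ((cmod (fourier_int (indicator U) \<xi>))\<^sup>2) \<partial>lebesgue)"
  proof (intro Limsup_bounded always_eventually allI)
    fix n
    have "(\<integral>\<^sup>+p. ?g n p \<partial>(lborel \<Otimes>\<^sub>M lborel))
      = (\<integral>\<^sup>+\<xi>. ennreal ((cmod (fourier_int (indicator U) \<xi>))\<^sup>2 * gauss (?s n) \<xi>) \<partial>lebesgue)"
      unfolding U_def by (rule nn_integral_indicator_heat_kernel[symmetric]) simp
    \<comment> \<open>The regulariser is at most 1, so dropping it only increases the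
      integral.\<close>
    also have "\<dots> \<le> (\<integral>\<^sup>+\<xi>. ennreal ((cmod (fourier_int (indicator U) \<xi>))\<^sup>2) \<partial>lebesgue)"
      by (intro nn_integral_mono ennreal_leI mult_left_le gauss_le_1) simp
    finally show "(\<integral>\<^sup>+p. ?g n p \<partial>(lborel \<Otimes>\<^sub>M lborel))
      \<le> (\<integral>\<^sup>+\<xi>. ennreal ((cmod (fourier_int (indicator U) \<xi>))\<^sup>2) \<partial>lebesgue)" .
  qed
  finally show ?thesis .
qed

section \<open>The Fourier transform on L2\<close>

text \<open>Cutting off to a ball puts an L2 function into L1, where the Fourier integral is
  meaningful. The expression agrees with the one inside the choice in
  \<open>fourier_L2\<close>.\<close>

abbreviation ball_truncation :: "nat \<Rightarrow> ('a::euclidean_space \<Rightarrow> complex) \<Rightarrow> 'a \<Rightarrow> complex" where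
  "ball_truncation k u \<equiv> \<lambda>x. indicator (ball 0 (real k)) x * u x"

lemma square_integrable_ball_truncation:
  fixes u :: "'a::euclidean_space \<Rightarrow> complex"
  assumes "square_integrable u"
  shows "square_integrable (ball_truncation k u)"
proof (rule square_integrable_bound[OF assms, where C = 1])
  have [measurable]: "u \<in> borel_measurable lebesgue" "ball (0::'a) (real k) \<in> sets lebesgue"
    using assms by (auto simp: square_integrable_iff fmeasurableD)
  show "ball_truncation k u \<in> borel_measurable lebesgue"
    by measurable
qed (auto split: split_indicator)

lemma integrable_ball_truncation:
  fixes u :: "'a::euclidean_space \<Rightarrow> complex"
  assumes "square_integrable u"
  shows "integrable lebesgue (ball_truncation k u)"
proof (rule square_integrable_mult_integrable[OF _ assms])
  have [measurable]: "ball (0::'a) (real k) \<in> sets lebesgue"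
    by (simp add: fmeasurableD)
  have "(\<integral>\<^sup>+ x. ennreal ((cmod (indicator (ball (0::'a) (real k)) x))\<^sup>2) \<partial>lebesgue)
    = (\<integral>\<^sup>+ x. indicator (ball (0::'a) (real k)) x \<partial>lebesgue)"
    by (intro nn_integral_cong) (simp add: indicator_def)
  also have "\<dots> < \<infinity>"
    using fmeasurableD2[OF lmeasurable_ball[of "0::'a" "real k"]] by (simp add: less_top)
  finally show "square_integrable (indicator (ball (0::'a) (real k)))"
    unfolding square_integrable_def by simp
qed

lemma fourier_int_diff:
  fixes f g :: "'a::euclidean_space \<Rightarrow> complex"
  assumes "integrable lebesgue f" "integrable lebesgue g"
  shows "fourier_int (\<lambda>x. f x - g x) \<xi> = fourier_int f \<xi> - fourier_int g \<xi>"
  unfolding fourier_int_def left_diff_distrib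
  by (intro Bochner_Integration.integral_diff integrable_fourier_kernel assms)

lemma fourier_int_L2:
  fixes f :: "'a::euclidean_space \<Rightarrow> complex"
  assumes f: "integrable lebesgue f" "square_integrable f"
  shows "square_integrable (fourier_int f)"
    and "(L2_norm_fun (fourier_int f))\<^sup>2 \<le> (2 * pi) ^ DIM('a) * (L2_norm_fun f)\<^sup>2"
proof -
  have le: "(\<integral>\<^sup>+\<xi>. ennreal ((cmod (fourier_int f \<xi>))\<^sup>2) \<partial>lebesgue)
    \<le> ennreal ((2 * pi) ^ DIM('a) * (L2_norm_fun f)\<^sup>2)"
    using fourier_int_contraction[OF f(1)] unfolding nn_integral_L2[OF f(2)]
    by (simp add: ennreal_mult)
  show sq: "square_integrable (fourier_int f)"
    unfolding square_integrable_def
    using le f(1) by (auto intro!: fourier_int_measurable elim: le_less_trans)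
  show "(L2_norm_fun (fourier_int f))\<^sup>2 \<le> (2 * pi) ^ DIM('a) * (L2_norm_fun f)\<^sup>2"
    using le unfolding nn_integral_L2[OF sq] by simp
qed

lemma L2_norm_fourier_int_le:
  fixes f :: "'a::euclidean_space \<Rightarrow> complex"
  assumes f: "integrable lebesgue f" "square_integrable f"
  shows "L2_norm_fun (fourier_int f) \<le> sqrt ((2 * pi) ^ DIM('a)) * L2_norm_fun f"
  using real_sqrt_le_mono[OF fourier_int_L2(2)[OF f]]
  by (simp add: real_sqrt_mult L2_norm_fun_nonneg)

text \<open>The norm bound on L1 \<inter> L2 carries the Cauchy property from the truncations to
  their transforms, and completeness gives a limit. Hence the choice in \<open>fourier_L2\<close>
  has a witness.\<close>

lemma fourier_L2_exists:
  fixes u :: "'a::euclidean_space \<Rightarrow> complex"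
  assumes u: "square_integrable u"
  shows "\<exists>g. square_integrable g \<and>
    (\<lambda>k. L2_norm_fun (\<lambda>\<xi>. fourier_int (ball_truncation k u) \<xi> - g \<xi>)) \<longlonglongrightarrow> 0"
proof (rule L2_complete)
  note t = square_integrable_ball_truncation[OF u] integrable_ball_truncation[OF u]
  show "square_integrable (fourier_int (ball_truncation k u))" for k
    by (intro fourier_int_L2 t)
  let ?C = "sqrt ((2 * pi) ^ DIM('a))"
  have C: "?C > 0" by simp
  fix e :: real assume "e > 0"
  then have "e / (2 * ?C) > 0" using C by simp
  from LIMSEQ_D[OF L2_truncation_tendsto[OF u] this]
  obtain N where N: "\<And>k. k \<ge> N \<Longrightarrow> L2_norm_fun (\<lambda>x. ball_truncation k u x - u x) < e / (2 * ?C)"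
    by (auto simp: L2_norm_fun_nonneg)
  have "L2_norm_fun (\<lambda>\<xi>. fourier_int (ball_truncation m u) \<xi> - fourier_int (ball_truncation n u) \<xi>) < e"
    if "m \<ge> N" "n \<ge> N" for m n
  proof -
    have i: "integrable lebesgue (\<lambda>x. ball_truncation m u x - ball_truncation n u x)"
      by (intro Bochner_Integration.integrable_diff t)
    have "L2_norm_fun (\<lambda>\<xi>. fourier_int (ball_truncation m u) \<xi> - fourier_int (ball_truncation n u) \<xi>)
      \<le> ?C * L2_norm_fun (\<lambda>x. ball_truncation m u x - ball_truncation n u x)"
      using L2_norm_fourier_int_le[OF i square_integrable_diff[OF t(1) t(1)]]
      unfolding fourier_int_diff[OF t(2) t(2), abs_def] .
    also have "L2_norm_fun (\<lambda>x. ball_truncation m u x - ball_truncation n u x)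
      \<le> L2_norm_fun (\<lambda>x. ball_truncation m u x - u x) + L2_norm_fun (\<lambda>x. u x - ball_truncation n u x)"
      using L2_norm_fun_triangle[OF square_integrable_diff[OF t(1) u] square_integrable_diff[OF u t(1)], of m n]
      by simp
    also have "\<dots> < e / (2 * ?C) + e / (2 * ?C)"
      using N that L2_norm_fun_commute[of u] by (intro add_strict_mono) auto
    finally show ?thesis
      using C by (simp add: field_simps)
  qed
  then show "\<exists>N. \<forall>m\<ge>N. \<forall>n\<ge>N. L2_norm_fun (\<lambda>\<xi>. fourier_int (ball_truncation m u) \<xi> - fourier_int (ball_truncation n u) \<xi>) < e"
    by blast
qed

lemma
  fixes u :: "'a::euclidean_space \<Rightarrow> complex"
  assumes u: "square_integrable u"
  shows square_integrable_fourier_L2: "square_integrable (fourier_L2 u)"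
    and fourier_L2_tendsto:
      "(\<lambda>k. L2_norm_fun (\<lambda>\<xi>. fourier_int (ball_truncation k u) \<xi> - fourier_L2 u \<xi>)) \<longlonglongrightarrow> 0"
  using someI_ex[OF fourier_L2_exists[OF u]] unfolding fourier_L2_def by blast+

lemma L2_norm_fourier_L2_le:
  fixes u :: "'a::euclidean_space \<Rightarrow> complex"
  assumes u: "square_integrable u"
  shows "L2_norm_fun (fourier_L2 u) \<le> sqrt ((2 * pi) ^ DIM('a)) * L2_norm_fun u"
proof (rule LIMSEQ_le)
  note t = square_integrable_ball_truncation[OF u] integrable_ball_truncation[OF u]
  show "(\<lambda>k. L2_norm_fun (fourier_int (ball_truncation k u))) \<longlonglongrightarrow> L2_norm_fun (fourier_L2 u)"
    by (intro L2_norm_fun_tendsto fourier_int_L2 t square_integrable_fourier_L2 fourier_L2_tendsto u)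
  show "(\<lambda>k. sqrt ((2 * pi) ^ DIM('a)) * L2_norm_fun (ball_truncation k u)) \<longlonglongrightarrow> sqrt ((2 * pi) ^ DIM('a)) * L2_norm_fun u"
    by (intro tendsto_mult tendsto_const L2_norm_fun_tendsto t u L2_truncation_tendsto)
  show "\<exists>N. \<forall>n\<ge>N. L2_norm_fun (fourier_int (ball_truncation n u)) \<le> sqrt ((2 * pi) ^ DIM('a)) * L2_norm_fun (ball_truncation n u)"
    using L2_norm_fourier_int_le t by blast
qed

text \<open>Both sides are limits of the L1 formula for truncations, because the bilinear pairing is
  continuous in L2.\<close>

lemma fourier_L2_multiplication_formula:
  fixes u v :: "'a::euclidean_space \<Rightarrow> complex"
  assumes u: "square_integrable u" and v: "square_integrable v"
  shows "(LINT \<xi>|lebesgue. fourier_L2 u \<xi> * v \<xi>) = (LINT x|lebesgue. u x * fourier_L2 v x)"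
proof (rule LIMSEQ_unique)
  note t = square_integrable_ball_truncation integrable_ball_truncation
  show "(\<lambda>k. LINT \<xi>|lebesgue. fourier_int (ball_truncation k u) \<xi> * ball_truncation k v \<xi>)
    \<longlonglongrightarrow> (LINT \<xi>|lebesgue. fourier_L2 u \<xi> * v \<xi>)"
    by (intro L2_integral_mult_tendsto fourier_int_L2 t square_integrable_fourier_L2 fourier_L2_tendsto
        L2_truncation_tendsto u v)
  have "(\<lambda>k. LINT \<xi>|lebesgue. ball_truncation k u \<xi> * fourier_int (ball_truncation k v) \<xi>)
    \<longlonglongrightarrow> (LINT x|lebesgue. u x * fourier_L2 v x)"
    by (intro L2_integral_mult_tendsto fourier_int_L2 t square_integrable_fourier_L2 fourier_L2_tendsto
        L2_truncation_tendsto u v)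
  then show "(\<lambda>k. LINT \<xi>|lebesgue. fourier_int (ball_truncation k u) \<xi> * ball_truncation k v \<xi>)
    \<longlonglongrightarrow> (LINT x|lebesgue. u x * fourier_L2 v x)"
    using fourier_int_multiplication_formula[OF t(2)[OF u] t(2)[OF v]] by simp
qed

text \<open>A transform defined by choice is compared with a concrete function only through this:
  two L2-limits of one sequence agree almost everywhere.\<close>

lemma L2_limit_unique:
  assumes "\<And>k. square_integrable (F k)" "square_integrable f" "square_integrable g"
    and "(\<lambda>k. L2_norm_fun (\<lambda>x. F k x - f x)) \<longlonglongrightarrow> 0" "(\<lambda>k. L2_norm_fun (\<lambda>x. F k x - g x)) \<longlonglongrightarrow> 0"
  shows "AE x in lebesgue. f x = g x"
proof -
  have "L2_norm_fun (\<lambda>x. f x - g x) \<le> L2_norm_fun (\<lambda>x. F k x - f x) + L2_norm_fun (\<lambda>x. F k x - g x)" for k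
    using L2_norm_fun_triangle[OF square_integrable_diff[OF assms(2) assms(1)[of k]] square_integrable_diff[OF assms(1)[of k] assms(3)]]
    by (simp add: L2_norm_fun_commute[of f])
  moreover have "(\<lambda>k. L2_norm_fun (\<lambda>x. F k x - f x) + L2_norm_fun (\<lambda>x. F k x - g x)) \<longlonglongrightarrow> 0 + 0"
    by (intro tendsto_add assms)
  ultimately have "L2_norm_fun (\<lambda>x. f x - g x) \<le> 0 + 0"
    by (intro LIMSEQ_le_const) auto
  then have "L2_norm_fun (\<lambda>x. f x - g x) = 0"
    using L2_norm_fun_nonneg[of "\<lambda>x. f x - g x"] by simp
  from L2_norm_fun_eq_0_AE[OF square_integrable_diff[OF assms(2,3)] this]
  show ?thesis by simp
qed

section \<open>The inverse transform, reduced to the forward one by conjugation\<close>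

lemma inv_fourier_int_conv_fourier_int:
  fixes v :: "'a::euclidean_space \<Rightarrow> complex"
  shows "inv_fourier_int v x = complex_of_real (1 / (2 * pi) ^ DIM('a)) * cnj (fourier_int (\<lambda>\<xi>. cnj (v \<xi>)) x)"
proof -
  have p: "(2 * pi) powr (- real DIM('a)) = 1 / (2 * pi) ^ DIM('a)"
    by (simp add: powr_minus powr_realpow inverse_eq_divide)
  have "cnj (fourier_int (\<lambda>\<xi>. cnj (v \<xi>)) x) = (LINT \<xi>|lebesgue. cnj (cnj (v \<xi>) * fourier_kernel \<xi> x))"
    unfolding fourier_int_def by (simp del: complex_cnj_mult)
  also have "\<dots> = (LINT \<xi>|lebesgue. v \<xi> * exp (\<i> * complex_of_real (x \<bullet> \<xi>)))"
    by (simp add: exp_cnj inner_commute)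
  finally show ?thesis
    unfolding inv_fourier_int_def p by simp
qed

lemma
  fixes v :: "'a::euclidean_space \<Rightarrow> complex"
  assumes v: "square_integrable v"
  shows square_integrable_inv_fourier_L2: "square_integrable (inv_fourier_L2 v)"
    and inv_fourier_L2_AE: "AE x in lebesgue. inv_fourier_L2 v x
      = complex_of_real (1 / (2 * pi) ^ DIM('a)) * cnj (fourier_L2 (\<lambda>\<xi>. cnj (v \<xi>)) x)"
proof -
  let ?c = "complex_of_real (1 / (2 * pi) ^ DIM('a))"
  let ?v = "\<lambda>\<xi>. cnj (v \<xi>)"
  let ?g = "\<lambda>x. ?c * cnj (fourier_L2 ?v x)"
  have v': "square_integrable ?v"
    by (rule square_integrable_cnj[OF v])
  have tr: "(\<lambda>\<xi>. cnj (ball_truncation k v \<xi>)) = ball_truncation k ?v" for k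
    by (auto simp: indicator_def)
  have inv: "inv_fourier_int (ball_truncation k v) = (\<lambda>x. ?c * cnj (fourier_int (ball_truncation k ?v) x))" for k
    by (intro ext) (simp only: inv_fourier_int_conv_fourier_int tr)
  have sq: "square_integrable (inv_fourier_int (ball_truncation k v))" for k
    unfolding inv
    by (intro square_integrable_cmult square_integrable_cnj fourier_int_L2 integrable_ball_truncation
        square_integrable_ball_truncation v')
  have g: "square_integrable ?g"
    by (intro square_integrable_cmult square_integrable_cnj square_integrable_fourier_L2 v')
  have "L2_norm_fun (\<lambda>x. inv_fourier_int (ball_truncation k v) x - ?g x)
    = cmod ?c * L2_norm_fun (\<lambda>x. fourier_int (ball_truncation k ?v) x - fourier_L2 ?v x)" for k
  proof -
    have "(\<lambda>x. inv_fourier_int (ball_truncation k v) x - ?g x)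
      = (\<lambda>x. ?c * cnj (fourier_int (ball_truncation k ?v) x - fourier_L2 ?v x))"
      unfolding inv by (simp only: right_diff_distrib complex_cnj_diff)
    then show ?thesis
      by (simp only: L2_norm_fun_cnj L2_norm_fun_cmult square_integrable_cnj square_integrable_diff
          fourier_int_L2 integrable_ball_truncation square_integrable_ball_truncation v'
          square_integrable_fourier_L2)
  qed
  moreover have "(\<lambda>k. cmod ?c * L2_norm_fun (\<lambda>x. fourier_int (ball_truncation k ?v) x - fourier_L2 ?v x)) \<longlonglongrightarrow> cmod ?c * 0"
    by (intro tendsto_mult tendsto_const fourier_L2_tendsto v')
  ultimately have lim: "(\<lambda>k. L2_norm_fun (\<lambda>x. inv_fourier_int (ball_truncation k v) x - ?g x)) \<longlonglongrightarrow> 0"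
    by (simp only: mult_zero_right)
  \<comment> \<open>The conjugated forward transform is a witness for the choice defining
    \<open>inv_fourier_L2\<close>; the chosen function may differ from it, but only on a null
    set.\<close>
  have *: "square_integrable (inv_fourier_L2 v) \<and>
     (\<lambda>k. L2_norm_fun (\<lambda>x. inv_fourier_int (ball_truncation k v) x - inv_fourier_L2 v x)) \<longlonglongrightarrow> 0"
    unfolding inv_fourier_L2_def by (rule someI[of _ ?g]) (use g lim in blast)
  then show "square_integrable (inv_fourier_L2 v)" by blast
  show "AE x in lebesgue. inv_fourier_L2 v x = ?g x"
    using * by (intro L2_limit_unique[OF sq _ g _ lim]) auto
qed

text \<open>The constant is (2 pi)^(-n) from the normalisation times (2 pi)^(n/2) from the forward
  transform, the reciprocal of the forward constant.\<close>

lemma L2_norm_inv_fourier_L2_le: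
  fixes v :: "'a::euclidean_space \<Rightarrow> complex"
  assumes v: "square_integrable v"
  shows "L2_norm_fun (inv_fourier_L2 v) \<le> 1 / sqrt ((2 * pi) ^ DIM('a)) * L2_norm_fun v"
proof -
  let ?N = "(2 * pi) ^ DIM('a)"
  let ?v = "\<lambda>\<xi>. cnj (v \<xi>)"
  have v': "square_integrable ?v"
    by (rule square_integrable_cnj[OF v])
  have "L2_norm_fun (inv_fourier_L2 v) = L2_norm_fun (\<lambda>x. complex_of_real (1 / ?N) * cnj (fourier_L2 ?v x))"
    by (rule L2_norm_fun_AE_cong[OF inv_fourier_L2_AE[OF v]])
  also have "\<dots> = 1 / ?N * L2_norm_fun (fourier_L2 ?v)"
    unfolding L2_norm_fun_cmult[OF square_integrable_cnj[OF square_integrable_fourier_L2[OF v']]] L2_norm_fun_cnj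
    by (simp add: norm_divide norm_power norm_mult)
  also have "\<dots> \<le> 1 / ?N * (sqrt ?N * L2_norm_fun ?v)"
    by (intro mult_left_mono L2_norm_fourier_L2_le v') simp
  also have "\<dots> = 1 / sqrt ?N * L2_norm_fun v"
  proof -
    have "1 / ?N * sqrt ?N = 1 / sqrt ?N"
      using real_sqrt_mult_self[of ?N] by (simp add: field_simps del: real_sqrt_mult_self)
    then show ?thesis
      by (simp only: L2_norm_fun_cnj mult.assoc[symmetric])
  qed
  finally show ?thesis .
qed

lemma inv_fourier_L2_multiplication_formula:
  fixes u v :: "'a::euclidean_space \<Rightarrow> complex"
  assumes u: "square_integrable u" and v: "square_integrable v"
  shows "(LINT \<xi>|lebesgue. inv_fourier_L2 u \<xi> * v \<xi>) = (LINT x|lebesgue. u x * inv_fourier_L2 v x)"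
proof -
  let ?c = "complex_of_real (1 / (2 * pi) ^ DIM('a))"
  let ?u = "\<lambda>\<xi>. cnj (u \<xi>)" and ?v = "\<lambda>\<xi>. cnj (v \<xi>)"
  note m = square_integrable_measurable[OF u] square_integrable_measurable[OF v]
    square_integrable_measurable[OF square_integrable_inv_fourier_L2[OF u]]
    square_integrable_measurable[OF square_integrable_inv_fourier_L2[OF v]]
    square_integrable_measurable[OF square_integrable_cmult[OF square_integrable_cnj[OF square_integrable_fourier_L2[OF square_integrable_cnj[OF u]]]]]
    square_integrable_measurable[OF square_integrable_cmult[OF square_integrable_cnj[OF square_integrable_fourier_L2[OF square_integrable_cnj[OF v]]]]]
  have "(LINT \<xi>|lebesgue. inv_fourier_L2 u \<xi> * v \<xi>) = (LINT \<xi>|lebesgue. ?c * cnj (fourier_L2 ?u \<xi>) * v \<xi>)"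
    using inv_fourier_L2_AE[OF u] by (intro integral_cong_AE borel_measurable_times m) auto
  also have "\<dots> = (LINT \<xi>|lebesgue. ?c * cnj (fourier_L2 ?u \<xi> * ?v \<xi>))"
    by (simp add: mult.assoc)
  also have "\<dots> = ?c * cnj (LINT \<xi>|lebesgue. fourier_L2 ?u \<xi> * ?v \<xi>)"
    by (simp del: complex_cnj_mult)
  also have "(LINT \<xi>|lebesgue. fourier_L2 ?u \<xi> * ?v \<xi>) = (LINT x|lebesgue. ?u x * fourier_L2 ?v x)"
    by (intro fourier_L2_multiplication_formula square_integrable_cnj u v)
  also have "?c * cnj \<dots> = (LINT x|lebesgue. ?c * cnj (?u x * fourier_L2 ?v x))"
    by (simp del: complex_cnj_mult)
  also have "\<dots> = (LINT x|lebesgue. u x * (?c * cnj (fourier_L2 ?v x)))"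
    by (simp add: mult_ac)
  also have "\<dots> = (LINT x|lebesgue. u x * inv_fourier_L2 v x)"
    using inv_fourier_L2_AE[OF v] by (intro integral_cong_AE borel_measurable_times m) auto
  finally show ?thesis .
qed

lemma square_integrable_indicator_box:
  "square_integrable (indicator (box a b) :: 'a::euclidean_space \<Rightarrow> complex)"
proof -
  have "(\<lambda>x. (cmod (indicator (box a b) x))\<^sup>2) = (indicator (box a b) :: 'a \<Rightarrow> real)"
    by (auto simp: indicator_def)
  then show ?thesis
    unfolding square_integrable_iff using integrable_indicator_box[of a b] by auto
qed

text \<open>A box is bounded, so truncation to a large ball leaves its indicator unchanged and the
  defining sequence is eventually constant.\<close>

lemma fourier_L2_indicator_box:
  fixes a b :: "'a::euclidean_space"
  shows "AE \<xi> in lebesgue. fourier_L2 (indicator (box a b)) \<xi> = fourier_int (indicator (box a b)) \<xi>"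
proof -
  let ?u = "indicator (box a b) :: 'a \<Rightarrow> complex"
  note u = square_integrable_indicator_box[of a b] integrable_indicator_box(2)[of a b]
  obtain r where r: "box a b \<subseteq> ball 0 r"
    using bounded_subset_ballD[OF bounded_box] by blast
  have "\<forall>\<^sub>F k in sequentially. L2_norm_fun (\<lambda>\<xi>. fourier_int (ball_truncation k ?u) \<xi> - fourier_int ?u \<xi>) = 0"
    using eventually_ge_at_top[of "nat \<lceil>r\<rceil>"]
  proof eventually_elim
    case (elim k)
    then have "r \<le> real k" by linarith
    then have "box a b \<subseteq> ball 0 (real k)"
      using r subset_ball by blast
    then have "ball_truncation k ?u x = ?u x" for x
      by (cases "x \<in> box a b") (auto simp del: mem_ball)
    then have "ball_truncation k ?u = ?u"
      by (rule ext)
    then show ?case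
      by (simp only:) (simp add: L2_norm_fun_def)
  qed
  then have "(\<lambda>k. L2_norm_fun (\<lambda>\<xi>. fourier_int (ball_truncation k ?u) \<xi> - fourier_int ?u \<xi>)) \<longlonglongrightarrow> 0"
    by (rule tendsto_eventually)
  then show ?thesis
    by (intro L2_limit_unique[OF _ _ _ fourier_L2_tendsto])
       (intro fourier_int_L2 u square_integrable_fourier_L2 square_integrable_ball_truncation integrable_ball_truncation | assumption)+
qed

lemma L2_norm_indicator_box:
  "(L2_norm_fun (indicator (box a b) :: 'a::euclidean_space \<Rightarrow> complex))\<^sup>2 = measure lborel (box a b)"
proof -
  have "(\<lambda>x. (cmod (indicator (box a b) x))\<^sup>2) = (indicator (box a b) :: 'a \<Rightarrow> real)"
    by (auto simp: indicator_def)
  then show ?thesis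
    by (simp add: L2_norm_fun_sq square_integrable_indicator_box)
qed

section \<open>Fourier inversion, on boxes and then on all of L2\<close>

lemma L2_norm_diff_sq:
  assumes "square_integrable f" "square_integrable g"
  shows "(L2_norm_fun (\<lambda>x. f x - g x))\<^sup>2
    = (L2_norm_fun f)\<^sup>2 - 2 * Re (LINT x|lebesgue. f x * cnj (g x)) + (L2_norm_fun g)\<^sup>2"
proof -
  have i: "integrable lebesgue (\<lambda>x. f x * cnj (g x))"
    by (intro square_integrable_mult_integrable square_integrable_cnj assms)
  have e: "(cmod (f x - g x))\<^sup>2 = (cmod (f x))\<^sup>2 - 2 * Re (f x * cnj (g x)) + (cmod (g x))\<^sup>2" for x
    unfolding cmod_power2 by (simp add: power2_eq_square algebra_simps)
  have "(L2_norm_fun (\<lambda>x. f x - g x))\<^sup>2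
    = (LINT x|lebesgue. (cmod (f x))\<^sup>2 - 2 * Re (f x * cnj (g x)) + (cmod (g x))\<^sup>2)"
    unfolding L2_norm_fun_sq[OF square_integrable_diff[OF assms]] e ..
  also have "\<dots> = (LINT x|lebesgue. (cmod (f x))\<^sup>2) - 2 * (LINT x|lebesgue. Re (f x * cnj (g x)))
      + (LINT x|lebesgue. (cmod (g x))\<^sup>2)"
    using assms integrable_Re[OF i] by (simp add: square_integrable_iff del: times_complex.sel)
  also have "(LINT x|lebesgue. Re (f x * cnj (g x))) = Re (LINT x|lebesgue. f x * cnj (g x))"
    by (rule integral_Re[OF i])
  finally show ?thesis
    by (simp only: L2_norm_fun_sq assms)
qed

text \<open>With w = F^-1 F u, the norm of w is at most that of u, while the lower bound for boxes
  makes the inner product of w and u at least the square of the norm of u. Expanding the square of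
  the norm of w - u then leaves nothing.\<close>

lemma inv_fourier_L2_fourier_L2_box:
  fixes a b :: "'a::euclidean_space"
  defines "u \<equiv> indicator (box a b) :: 'a \<Rightarrow> complex"
  shows "AE x in lebesgue. inv_fourier_L2 (fourier_L2 u) x = u x"
proof -
  let ?N = "(2 * pi) ^ DIM('a)"
  let ?m = "measure lborel (box a b)"
  let ?\<phi> = "fourier_L2 u" and ?w = "inv_fourier_L2 (fourier_L2 u)"
  have N: "?N > 0" by simp
  have u: "square_integrable u"
    unfolding u_def by (rule square_integrable_indicator_box)
  have um: "(L2_norm_fun u)\<^sup>2 = ?m"
    unfolding u_def by (rule L2_norm_indicator_box)
  note \<phi> = square_integrable_fourier_L2[OF u]
  note w = square_integrable_inv_fourier_L2[OF \<phi>]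
  have cnj_u: "(\<lambda>x. cnj (u x)) = u"
    unfolding u_def by (auto simp: indicator_def)
  have ge: "?N * ?m \<le> (L2_norm_fun ?\<phi>)\<^sup>2"
  proof -
    have sq: "square_integrable (fourier_int u)"
      unfolding u_def by (intro fourier_int_L2 integrable_indicator_box square_integrable_indicator_box)
    have "emeasure lborel (box a b) = ennreal ?m"
      using emeasure_lborel_box_finite[of a b] by (intro emeasure_eq_ennreal_measure) simp
    then have "ennreal (?N * ?m) = ennreal ?N * emeasure lborel (box a b)"
      by (simp only:) (rule ennreal_mult, simp_all)
    also have "\<dots> \<le> (\<integral>\<^sup>+\<xi>. ennreal ((cmod (fourier_int u \<xi>))\<^sup>2) \<partial>lebesgue)"
      unfolding u_def by (rule fourier_int_box_ge)
    also have "\<dots> = ennreal ((L2_norm_fun (fourier_int u))\<^sup>2)"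
      by (rule nn_integral_L2[OF sq])
    also have "L2_norm_fun (fourier_int u) = L2_norm_fun ?\<phi>"
      unfolding u_def using fourier_L2_indicator_box[of a b]
      by (intro L2_norm_fun_AE_cong) (auto elim: eventually_mono)
    finally show ?thesis by simp
  qed
  \<comment> \<open>The constants of the two transforms are reciprocal, so F^-1 F does not increase
    the norm.\<close>
  have "L2_norm_fun ?w \<le> 1 / sqrt ?N * (sqrt ?N * L2_norm_fun u)"
    by (rule order_trans[OF L2_norm_inv_fourier_L2_le[OF \<phi>] mult_left_mono[OF L2_norm_fourier_L2_le[OF u]]]) simp
  then have "L2_norm_fun ?w \<le> L2_norm_fun u"
    using N by simp
  then have wm: "(L2_norm_fun ?w)\<^sup>2 \<le> ?m"
    unfolding um[symmetric] by (intro power_mono L2_norm_fun_nonneg)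
  have "(LINT x|lebesgue. ?w x * cnj (u x)) = (LINT x|lebesgue. ?w x * u x)"
    using cnj_u by (metis (no_types))
  also have "\<dots> = (LINT x|lebesgue. ?\<phi> x * inv_fourier_L2 u x)"
    by (rule inv_fourier_L2_multiplication_formula[OF \<phi> u])
  \<comment> \<open>As u is real, F^-1 u is (2 pi)^(-n) times the conjugate of F u, which turns the
    pairing into an integral of |F u|^2.\<close>
  also have "\<dots> = (LINT x|lebesgue. complex_of_real (1 / ?N * (cmod (?\<phi> x))\<^sup>2))"
  proof (rule integral_cong_AE)
    note m = square_integrable_measurable[OF \<phi>] square_integrable_measurable[OF square_integrable_inv_fourier_L2[OF u]]
    show "(\<lambda>x. ?\<phi> x * inv_fourier_L2 u x) \<in> borel_measurable lebesgue"
      by (intro borel_measurable_times m)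
    show "(\<lambda>x. complex_of_real (1 / ?N * (cmod (?\<phi> x))\<^sup>2)) \<in> borel_measurable lebesgue"
      using m(1) by measurable
    show "AE x in lebesgue. ?\<phi> x * inv_fourier_L2 u x = complex_of_real (1 / ?N * (cmod (?\<phi> x))\<^sup>2)"
      using inv_fourier_L2_AE[OF u]
    proof eventually_elim
      case (elim x)
      have "?\<phi> x * inv_fourier_L2 u x = complex_of_real (1 / ?N) * (?\<phi> x * cnj (?\<phi> x))"
        unfolding elim cnj_u by (simp only: mult_ac)
      then show ?case
        by (simp only: complex_norm_square[symmetric] of_real_mult)
    qed
  qed
  also have "\<dots> = complex_of_real (1 / ?N * (L2_norm_fun ?\<phi>)\<^sup>2)"
    by (simp only: integral_complex_of_real integral_mult_right_zero L2_norm_fun_sq[OF \<phi>])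
  finally have ip: "Re (LINT x|lebesgue. ?w x * cnj (u x)) = 1 / ?N * (L2_norm_fun ?\<phi>)\<^sup>2"
    by simp
  have "(L2_norm_fun (\<lambda>x. ?w x - u x))\<^sup>2 = (L2_norm_fun ?w)\<^sup>2 - 2 * (1 / ?N * (L2_norm_fun ?\<phi>)\<^sup>2) + ?m"
    unfolding L2_norm_diff_sq[OF w u] ip um ..
  also have "\<dots> \<le> ?m - 2 * (1 / ?N * (?N * ?m)) + ?m"
    using N by (intro add_mono diff_mono mult_left_mono wm ge) auto
  also have "\<dots> = 0"
    using N by simp
  finally have "L2_norm_fun (\<lambda>x. ?w x - u x) = 0"
    by simp
  from L2_norm_fun_eq_0_AE[OF square_integrable_diff[OF w u] this]
  show ?thesis by simp
qed

text \<open>By Lebesgue differentiation h is almost everywhere the limit of its averages over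
  shrinking cubes, and all these averages vanish.\<close>

lemma AE_zero_if_box_integrals_zero:
  fixes h :: "'a::euclidean_space \<Rightarrow> complex"
  assumes h: "square_integrable h"
    and zero: "\<And>a b. (LINT x|lebesgue. h x * indicator (box a b) x) = 0"
  shows "AE x in lebesgue. h x = 0"
proof -
  have set: "set_integrable lebesgue (box a b) h" for a b
  proof -
    have "integrable lebesgue (\<lambda>x. h x * indicator (box a b) x)"
      by (intro square_integrable_mult_integrable h square_integrable_indicator_box)
    moreover have "h x * indicator (box a b) x = indicat_real (box a b) x *\<^sub>R h x" for x
      by (simp add: indicator_def)
    ultimately show ?thesis
      unfolding set_integrable_def by (simp only:)
  qed
  have "h integrable_on box a b" for a b
    using set_lebesgue_integral_eq_integral(1)[OF set] .
  then have int: "h integrable_on cbox a b" for a b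
    by (simp add: integrable_on_open_interval)
  have "integral (box a b) h = 0" for a b
  proof -
    have "integral (box a b) h = (LINT x:box a b|lebesgue. h x)"
      using set_lebesgue_integral_eq_integral(2)[OF set] by simp
    also have "\<dots> = (LINT x|lebesgue. h x * indicator (box a b) x)"
      unfolding set_lebesgue_integral_def
      by (intro Bochner_Integration.integral_cong) (auto simp: indicator_def)
    finally show ?thesis
      using zero by simp
  qed
  then have z: "integral (cbox a b) h = 0" for a b
    by (simp add: integral_open_interval)
  \<comment> \<open>The cubes have x as a corner. Taking e = norm (h x) at a point with h x \<noteq>
    0 would give norm (h x) < norm (h x).\<close>
  obtain N where N: "negligible N" "\<And>x e. \<lbrakk>x \<notin> N; 0 < e\<rbrakk> \<Longrightarrow>
      \<exists>d>0. \<forall>t. 0 < t \<and> t < d \<longrightarrow> norm (integral (cbox x (x + t *\<^sub>R One)) h /\<^sub>R t ^ DIM('a) - h x) < e"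
    using integrable_ccontinuous_explicit[OF int] by blast
  have "h x = 0" if x: "x \<notin> N" for x
  proof (rule ccontr)
    assume "h x \<noteq> 0"
    then obtain d where d: "d > 0" "\<And>t. 0 < t \<and> t < d \<Longrightarrow> norm (integral (cbox x (x + t *\<^sub>R One)) h /\<^sub>R t ^ DIM('a) - h x) < norm (h x)"
      using N(2)[OF x, of "norm (h x)"] by auto
    from d(2)[of "d / 2"] d(1) show False
      by (simp add: z)
  qed
  then have "{x \<in> space lebesgue. h x \<noteq> 0} \<subseteq> N"
    by auto
  moreover have "N \<in> null_sets lebesgue"
    using N(1) by (simp add: negligible_iff_null_sets)
  ultimately show ?thesis
    by (intro AE_I'[of N]) auto
qed

text \<open>Paired with the indicator of a box, the operators F and F^-1 move onto that indicator in
  reversed order, so the known case of F^-1 F on boxes yields F F^-1 on every g.\<close>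

lemma fourier_L2_inv_fourier_L2:
  fixes g :: "'a::euclidean_space \<Rightarrow> complex"
  assumes g: "square_integrable g"
  shows "AE x in lebesgue. fourier_L2 (inv_fourier_L2 g) x = g x"
proof -
  let ?w = "inv_fourier_L2 g"
  note w = square_integrable_inv_fourier_L2[OF g]
  note fw = square_integrable_fourier_L2[OF w]
  have "AE x in lebesgue. fourier_L2 ?w x - g x = 0"
  proof (rule AE_zero_if_box_integrals_zero)
    show "square_integrable (\<lambda>x. fourier_L2 ?w x - g x)"
      by (intro square_integrable_diff fw g)
    fix a b :: 'a
    let ?u = "indicator (box a b) :: 'a \<Rightarrow> complex"
    note u = square_integrable_indicator_box[of a b]
    have "(LINT x|lebesgue. fourier_L2 ?w x * ?u x) = (LINT x|lebesgue. ?w x * fourier_L2 ?u x)"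
      by (rule fourier_L2_multiplication_formula[OF w u])
    also have "\<dots> = (LINT x|lebesgue. g x * inv_fourier_L2 (fourier_L2 ?u) x)"
      by (rule inv_fourier_L2_multiplication_formula[OF g square_integrable_fourier_L2[OF u]])
    also have "\<dots> = (LINT x|lebesgue. g x * ?u x)"
      using inv_fourier_L2_fourier_L2_box[of a b]
      by (intro integral_cong_AE borel_measurable_times square_integrable_measurable g u
          square_integrable_inv_fourier_L2 square_integrable_fourier_L2) auto
    finally have "(LINT x|lebesgue. fourier_L2 ?w x * ?u x) - (LINT x|lebesgue. g x * ?u x) = 0"
      by simp
    then show "(LINT x|lebesgue. (fourier_L2 ?w x - g x) * ?u x) = 0"
      unfolding left_diff_distrib
      by (subst Bochner_Integration.integral_diff) (intro square_integrable_mult_integrable fw g u | assumption)+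
  qed
  then show ?thesis by simp
qed

text \<open>The real part of the kernel is cos (x \<bullet> \<xi>). On the cube the l1 bound gives
  |x| \<le> n r, hence |x \<bullet> \<xi>| \<le> pi / 3 and the cosine is at least 1 / 2; so the
  real part of the transform is at least half the volume.\<close>

lemma fourier_int_box_nonzero:
  fixes \<xi> :: "'a::euclidean_space" and r :: real
  assumes r: "r > 0" "DIM('a) * r * norm \<xi> \<le> pi / 3"
  shows "fourier_int (indicator (box (- r *\<^sub>R One) (r *\<^sub>R One))) \<xi> \<noteq> 0"
proof -
  let ?U = "box (- r *\<^sub>R One) (r *\<^sub>R One) :: 'a set"
  have i: "integrable lebesgue (\<lambda>x. indicator ?U x * fourier_kernel x \<xi>)"
    by (intro integrable_fourier_kernel integrable_indicator_box)
  have "(1 / 2) * measure lborel ?U = (LINT x|lebesgue. (1 / 2) * indicator ?U x)"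
    by simp
  also have "\<dots> \<le> (LINT x|lebesgue. Re (indicator ?U x * fourier_kernel x \<xi>))"
  proof (rule integral_mono)
    show "integrable lebesgue (\<lambda>x. (1 / 2) * indicator ?U x :: real)"
      by (intro integrable_mult_right integrable_indicator_box)
    show "integrable lebesgue (\<lambda>x. Re (indicator ?U x * fourier_kernel x \<xi>))"
      by (rule integrable_Re[OF i])
    fix x :: 'a
    show "(1 / 2) * indicator ?U x \<le> Re (indicator ?U x * fourier_kernel x \<xi>)"
    proof (cases "x \<in> ?U")
      case True
      have "norm x \<le> (\<Sum>b\<in>Basis. \<bar>x \<bullet> b\<bar>)"
        by (rule norm_le_l1)
      also have "\<dots> \<le> (\<Sum>b\<in>(Basis::'a set). r)"
        using True by (intro sum_mono) (auto simp: box_def abs_le_iff intro: less_imp_le)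
      finally have "norm x \<le> DIM('a) * r"
        by simp
      then have "norm x * norm \<xi> \<le> pi / 3"
        using r(2) by (meson mult_right_mono norm_ge_zero order_trans)
      then have "\<bar>x \<bullet> \<xi>\<bar> \<le> pi / 3"
        using Cauchy_Schwarz_ineq2[of x \<xi>] by linarith
      then have "cos (pi / 3) \<le> cos \<bar>x \<bullet> \<xi>\<bar>"
        by (intro cos_monotone_0_pi_le) auto
      then have "1 / 2 \<le> cos (x \<bullet> \<xi>)"
        by (simp add: cos_60)
      with True show ?thesis
        by (simp add: Re_exp)
    qed simp
  qed
  also have "\<dots> = Re (fourier_int (indicator ?U) \<xi>)"
    unfolding fourier_int_def by (rule integral_Re[OF i])
  finally have "(1 / 2) * measure lborel ?U \<le> Re (fourier_int (indicator ?U) \<xi>)" .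
  moreover have "measure lborel ?U > 0"
    using r(1) by (subst measure_lborel_box) (auto simp: inner_diff_left inner_add_left intro!: prod_pos)
  ultimately show ?thesis
    by auto
qed

section \<open>Associate norms and multipliers\<close>

lemma box_emeasure_lebesgue_finite:
  "box a b \<in> sets lebesgue" "emeasure lebesgue (box a b :: 'a::euclidean_space set) < \<infinity>"
  using emeasure_lborel_box_finite[of a b] by simp_all

lemma
  assumes "banach_function_norm \<rho>"
  shows bfn_zero_iff: "\<And>f. f \<in> borel_measurable lebesgue \<Longrightarrow> \<rho> f = 0 \<longleftrightarrow> (AE x in lebesgue. f x = 0)"
    and bfn_cmult: "\<And>f c. f \<in> borel_measurable lebesgue \<Longrightarrow> c \<ge> 0 \<Longrightarrow> \<rho> (\<lambda>x. ennreal c * f x) = ennreal c * \<rho> f"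
    and bfn_indicator: "\<And>E. E \<in> sets lebesgue \<Longrightarrow> emeasure lebesgue E < \<infinity> \<Longrightarrow> \<rho> (indicator E) < \<infinity>"
    and bfn_local_integral: "\<And>E. E \<in> sets lebesgue \<Longrightarrow> emeasure lebesgue E < \<infinity> \<Longrightarrow>
      \<exists>C::real. \<forall>f \<in> borel_measurable lebesgue. (\<integral>\<^sup>+ x \<in> E. f x \<partial>lebesgue) \<le> ennreal C * \<rho> f"
proof -
  note A = assms[unfolded banach_function_norm_def]
  show "\<rho> f = 0 \<longleftrightarrow> (AE x in lebesgue. f x = 0)" if "f \<in> borel_measurable lebesgue" for f
    using conjunct1[OF A] that by (rule bspec)
  show "\<rho> (\<lambda>x. ennreal c * f x) = ennreal c * \<rho> f" if "f \<in> borel_measurable lebesgue" "c \<ge> 0" for f c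
    using conjunct1[OF conjunct2[OF A], rule_format, OF that] .
  show "\<rho> (indicator E) < \<infinity>" if "E \<in> sets lebesgue" "emeasure lebesgue E < \<infinity>" for E
    using conjunct1[OF conjunct2[OF conjunct2[OF conjunct2[OF conjunct2[OF conjunct2[OF A]]]]], rule_format, OF that] .
  show "\<exists>C::real. \<forall>f \<in> borel_measurable lebesgue. (\<integral>\<^sup>+ x \<in> E. f x \<partial>lebesgue) \<le> ennreal C * \<rho> f"
    if "E \<in> sets lebesgue" "emeasure lebesgue E < \<infinity>" for E
    using conjunct2[OF conjunct2[OF conjunct2[OF conjunct2[OF conjunct2[OF conjunct2[OF A]]]]]] that by simp
qed

text \<open>The constant from (A5) for the norm bounds the supremum, so this is (A4) for the
  associate norm.\<close>

lemma assoc_norm_indicator_finite: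
  assumes \<rho>: "banach_function_norm \<rho>" and E: "E \<in> sets lebesgue" "emeasure lebesgue E < \<infinity>"
  shows "assoc_norm \<rho> (indicator E) < \<infinity>"
proof -
  obtain C :: real where C: "\<And>f. f \<in> borel_measurable lebesgue \<Longrightarrow>
      (\<integral>\<^sup>+ x \<in> E. f x \<partial>lebesgue) \<le> ennreal C * \<rho> f"
    using bfn_local_integral[OF \<rho> E] by blast
  have "assoc_norm \<rho> (indicator E) \<le> ennreal C"
    unfolding assoc_norm_def
  proof (rule SUP_least)
    fix f assume f: "f \<in> {f \<in> borel_measurable lebesgue. \<rho> f \<le> 1}"
    then have "(\<integral>\<^sup>+ x. f x * indicator E x \<partial>lebesgue) \<le> ennreal C * \<rho> f"
      by (intro C) simp
    also have "\<dots> \<le> ennreal C * 1"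
      using f by (intro mult_left_mono) auto
    finally show "(\<integral>\<^sup>+ x. f x * indicator E x \<partial>lebesgue) \<le> ennreal C"
      by simp
  qed
  then show ?thesis
    by (rule le_less_trans) simp
qed

lemma assoc_norm_AE_zero:
  assumes "AE x in lebesgue. g x = 0"
  shows "assoc_norm \<rho> g = 0"
proof -
  have "(\<integral>\<^sup>+ x. f x * g x \<partial>lebesgue) = 0" for f
  proof -
    have "(\<integral>\<^sup>+ x. f x * g x \<partial>lebesgue) = (\<integral>\<^sup>+ x. 0 \<partial>(lebesgue :: 'a measure))"
      using assms by (intro nn_integral_cong_AE) auto
    then show ?thesis by simp
  qed
  then have "assoc_norm \<rho> g \<le> 0"
    unfolding assoc_norm_def by (intro SUP_least) simp
  then show ?thesis by simp
qed

text \<open>Scaling f by 1 / \<rho> f puts it into the unit ball over which the associate norm is a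
  supremum. When \<rho> f = 0 this is impossible, but then (A1) makes f vanish almost
  everywhere.\<close>

lemma assoc_norm_Holder:
  assumes \<rho>: "banach_function_norm \<rho>"
    and f [measurable]: "f \<in> borel_measurable lebesgue" and g [measurable]: "g \<in> borel_measurable lebesgue"
    and fin: "\<rho> f < \<infinity>"
  shows "(\<integral>\<^sup>+ x. f x * g x \<partial>lebesgue) \<le> \<rho> f * assoc_norm \<rho> g"
proof (cases "\<rho> f = 0")
  case True
  then have "AE x in lebesgue. f x = 0"
    by (simp add: bfn_zero_iff[OF \<rho> f])
  then have "(\<integral>\<^sup>+ x. f x * g x \<partial>lebesgue) = (\<integral>\<^sup>+ x. 0 \<partial>(lebesgue :: 'a measure))"
    by (intro nn_integral_cong_AE) auto
  then show ?thesis by simp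
next
  case False
  define r where "r = enn2real (\<rho> f)"
  have r: "\<rho> f = ennreal r" "r > 0"
    using fin False by (auto simp: r_def less_top enn2real_positive_iff zero_less_iff_neq_zero)
  have "\<rho> (\<lambda>x. ennreal (1 / r) * f x) = ennreal (1 / r) * \<rho> f"
    using r(2) by (intro bfn_cmult[OF \<rho> f]) simp
  also have "\<dots> = 1"
    using r by (simp add: ennreal_mult[symmetric])
  finally have "(\<lambda>x. ennreal (1 / r) * f x) \<in> {f \<in> borel_measurable lebesgue. \<rho> f \<le> 1}"
    by simp
  then have "(\<integral>\<^sup>+ x. ennreal (1 / r) * f x * g x \<partial>lebesgue) \<le> assoc_norm \<rho> g"
    unfolding assoc_norm_def by (rule SUP_upper)
  then have "ennreal r * (ennreal (1 / r) * (\<integral>\<^sup>+ x. f x * g x \<partial>lebesgue)) \<le> ennreal r * assoc_norm \<rho> g"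
    by (intro mult_left_mono) (simp_all add: nn_integral_cmult mult.assoc)
  moreover have "ennreal r * ennreal (1 / r) = 1"
    using r(2) by (simp add: ennreal_mult[symmetric])
  ultimately show ?thesis
    by (simp add: r(1) mult.assoc[symmetric])
qed

section \<open>Iterating a Fourier multiplier\<close>

lemma in_Linf_AE_bound:
  assumes "in_Linf a"
  shows "\<exists>C. AE x in lebesgue. cmod (a x) \<le> C"
proof (intro exI)
  have "AE x in lebesgue. ereal (cmod (a x)) \<le> Linf_enorm a"
    unfolding Linf_enorm_def by (rule esssup_AE)
  then show "AE x in lebesgue. cmod (a x) \<le> real_of_ereal (Linf_enorm a)"
  proof eventually_elim
    case (elim x)
    then show ?case
      using assms by (cases "Linf_enorm a") (auto simp: in_Linf_def)
  qed
qed

lemma square_integrable_Linf_mult: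
  assumes "in_Linf a" "square_integrable g"
  shows "square_integrable (\<lambda>x. a x * g x)"
proof -
  obtain C where C: "AE x in lebesgue. cmod (a x) \<le> C"
    using in_Linf_AE_bound[OF assms(1)] by blast
  show ?thesis
  proof (rule square_integrable_bound[OF assms(2)])
    show "(\<lambda>x. a x * g x) \<in> borel_measurable lebesgue"
      using assms by (auto simp: in_Linf_def square_integrable_iff)
    show "AE x in lebesgue. cmod (a x * g x) \<le> C * cmod (g x)"
      using C by (auto elim!: eventually_mono simp: norm_mult intro: mult_right_mono)
  qed
qed

lemma
  assumes "in_Linf a" "square_integrable u"
  shows square_integrable_multiplier_op: "square_integrable (multiplier_op a u)"
    and fourier_L2_multiplier_op: "AE x in lebesgue. fourier_L2 (multiplier_op a u) x = a x * fourier_L2 u x"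
proof -
  have "square_integrable (\<lambda>x. a x * fourier_L2 u x)"
    by (intro square_integrable_Linf_mult assms square_integrable_fourier_L2)
  then show "square_integrable (multiplier_op a u)"
    and "AE x in lebesgue. fourier_L2 (multiplier_op a u) x = a x * fourier_L2 u x"
    unfolding multiplier_op_def
    by (rule square_integrable_inv_fourier_L2, rule fourier_L2_inv_fourier_L2)
qed

text \<open>The supremum in \<open>multiplier_enorm\<close> leaves out functions vanishing almost
  everywhere, so these are treated separately. As the transforms are chosen limits, the L2 norm
  bounds are what sends null functions to null functions.\<close>

lemma multiplier_op_AE_zero:
  assumes a: "in_Linf a" and u: "square_integrable u" "AE x in lebesgue. u x = 0"
  shows "AE x in lebesgue. multiplier_op a u x = 0"
proof -
  have zero: "L2_norm_fun f = 0" if "AE x in lebesgue. f x = 0" for f :: "'a \<Rightarrow> complex"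
    using L2_norm_fun_AE_cong[OF that] by (simp add: L2_norm_fun_def)
  note fu = square_integrable_fourier_L2[OF u(1)]
  note afu = square_integrable_Linf_mult[OF a fu]
  have "L2_norm_fun (fourier_L2 u) = 0"
    using L2_norm_fourier_L2_le[OF u(1)] zero[OF u(2)] L2_norm_fun_nonneg[of "fourier_L2 u"] by simp
  from L2_norm_fun_eq_0_AE[OF fu this]
  have "AE x in lebesgue. a x * fourier_L2 u x = 0"
    by eventually_elim simp
  from zero[OF this] have "L2_norm_fun (multiplier_op a u) = 0"
    using L2_norm_inv_fourier_L2_le[OF afu] L2_norm_fun_nonneg[of "multiplier_op a u"]
    unfolding multiplier_op_def by simp
  then show ?thesis
    by (rule L2_norm_fun_eq_0_AE[OF square_integrable_multiplier_op[OF a u(1)]])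
qed

text \<open>A nonzero \<^typ>\<open>ennreal\<close> divided by 0 is \<open>\<infinity>\<close>, which a finite multiplier norm excludes.\<close>
lemma multiplier_op_bound:
  fixes \<nu> :: "('a::euclidean_space \<Rightarrow> ennreal) \<Rightarrow> ennreal"
  assumes zero: "\<And>f. f \<in> borel_measurable lebesgue \<Longrightarrow> AE x in lebesgue. f x = 0 \<Longrightarrow> \<nu> f = 0"
    and a: "a \<in> fourier_multipliers \<nu>"
    and u: "square_integrable u" "in_bfs \<nu> u"
  shows "bfs_enorm \<nu> (multiplier_op a u) \<le> multiplier_enorm \<nu> a * bfs_enorm \<nu> u"
proof (cases "AE x in lebesgue. u x = 0")
  case True
  have Linf: "in_Linf a"
    using a by (simp add: fourier_multipliers_def)
  have "multiplier_op a u \<in> borel_measurable lebesgue"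
    by (intro square_integrable_measurable square_integrable_multiplier_op Linf u)
  then have "\<nu> (\<lambda>x. ennreal (cmod (multiplier_op a u x))) = 0"
    using multiplier_op_AE_zero[OF Linf u(1) True] by (intro zero) auto
  then show ?thesis
    by (simp add: bfs_enorm_def)
next
  case False
  let ?M = "multiplier_enorm \<nu> a"
  have M: "?M < \<infinity>"
    using a by (simp add: fourier_multipliers_def)
  have fin: "bfs_enorm \<nu> u < \<infinity>"
    using u(2) by (simp add: in_bfs_def bfs_enorm_def)
  have le: "bfs_enorm \<nu> (multiplier_op a u) / bfs_enorm \<nu> u \<le> ?M"
    unfolding multiplier_enorm_def using u False by (intro SUP_upper) simp
  show ?thesis
  proof (cases "bfs_enorm \<nu> u = 0")
    case True
    then have "bfs_enorm \<nu> (multiplier_op a u) = 0"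
      using le M by (auto simp: divide_ennreal_def ennreal_mult_top split: if_splits)
    then show ?thesis by simp
  next
    case False
    then have "bfs_enorm \<nu> (multiplier_op a u) = bfs_enorm \<nu> (multiplier_op a u) / bfs_enorm \<nu> u * bfs_enorm \<nu> u"
      using fin by (simp add: ennreal_divide_times ennreal_divide_self mult_divide_eq_ennreal)
    also have "\<dots> \<le> ?M * bfs_enorm \<nu> u"
      using le by (rule mult_right_mono) simp
    finally show ?thesis .
  qed
qed

text \<open>Membership and bound go through one induction: the next application of the operator
  requires the iterate to lie in the domain of the supremum, and membership follows from finiteness
  of the bound. The general \<open>\<nu>\<close> stands for the norm and for its associate.\<close>

lemma multiplier_op_power_bound:
  fixes \<nu> :: "('a::euclidean_space \<Rightarrow> ennreal) \<Rightarrow> ennreal"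
  assumes zero: "\<And>f. f \<in> borel_measurable lebesgue \<Longrightarrow> AE x in lebesgue. f x = 0 \<Longrightarrow> \<nu> f = 0"
    and a: "a \<in> fourier_multipliers \<nu>"
    and u: "square_integrable u" "in_bfs \<nu> u"
  shows "in_bfs \<nu> ((multiplier_op a ^^ k) u) \<and>
    bfs_enorm \<nu> ((multiplier_op a ^^ k) u) \<le> multiplier_enorm \<nu> a ^ k * bfs_enorm \<nu> u"
proof (induction k)
  case 0
  then show ?case using u by simp
next
  case (Suc k)
  have Linf: "in_Linf a" and M: "multiplier_enorm \<nu> a < \<infinity>"
    using a by (simp_all add: fourier_multipliers_def)
  let ?v = "(multiplier_op a ^^ k) u"
  have sq: "square_integrable ((multiplier_op a ^^ n) u)" for n
    by (induction n) (simp_all add: u square_integrable_multiplier_op Linf)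
  have "bfs_enorm \<nu> (multiplier_op a ?v) \<le> multiplier_enorm \<nu> a * bfs_enorm \<nu> ?v"
    using Suc by (intro multiplier_op_bound zero a sq) auto
  also have "\<dots> \<le> multiplier_enorm \<nu> a * (multiplier_enorm \<nu> a ^ k * bfs_enorm \<nu> u)"
    using Suc by (intro mult_left_mono) auto
  finally have le: "bfs_enorm \<nu> (multiplier_op a ?v) \<le> multiplier_enorm \<nu> a ^ Suc k * bfs_enorm \<nu> u"
    by (simp add: mult.assoc)
  also have "\<dots> < \<infinity>"
    using M u(2) by (simp add: ennreal_mult_less_top in_bfs_def bfs_enorm_def power_less_top_ennreal del: power_Suc)
  finally have "bfs_enorm \<nu> (multiplier_op a ?v) < \<infinity>" .
  then have "in_bfs \<nu> (multiplier_op a ?v)"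
    using square_integrable_measurable[OF sq[of "Suc k"]] by (simp add: in_bfs_def bfs_enorm_def)
  with le show ?case by simp
qed

lemma fourier_L2_multiplier_op_power:
  assumes a: "in_Linf a" and u: "square_integrable u"
  shows "square_integrable ((multiplier_op a ^^ k) u) \<and>
    (AE x in lebesgue. fourier_L2 ((multiplier_op a ^^ k) u) x = a x ^ k * fourier_L2 u x)"
proof (induction k)
  case (Suc k)
  then have sq: "square_integrable ((multiplier_op a ^^ k) u)" by blast
  have "AE x in lebesgue. fourier_L2 (multiplier_op a ((multiplier_op a ^^ k) u)) x = a x ^ Suc k * fourier_L2 u x"
    using fourier_L2_multiplier_op[OF a sq] conjunct2[OF Suc]
    by eventually_elim simp
  then show ?case
    using square_integrable_multiplier_op[OF a sq] by simp
qed (use u in simp)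

text \<open>In |T^k u|^2 one factor is measured in \<rho> and the other in its associate norm, so
  each application of T costs one multiplier norm of each kind.\<close>

lemma nn_integral_multiplier_power_le:
  fixes \<rho> :: "('a::euclidean_space \<Rightarrow> ennreal) \<Rightarrow> ennreal"
  assumes \<rho>: "banach_function_norm \<rho>"
    and a: "a \<in> fourier_multipliers \<rho>" "a \<in> fourier_multipliers (assoc_norm \<rho>)"
    and u: "square_integrable u" "in_bfs \<rho> u" "in_bfs (assoc_norm \<rho>) u"
  shows "(\<integral>\<^sup>+\<xi>. ennreal ((cmod (a \<xi> ^ k * fourier_L2 u \<xi>))\<^sup>2) \<partial>lebesgue)
    \<le> ennreal ((2 * pi) ^ DIM('a)) * (bfs_enorm \<rho> u * bfs_enorm (assoc_norm \<rho>) u) *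
        (multiplier_enorm \<rho> a * multiplier_enorm (assoc_norm \<rho>) a) ^ k"
proof -
  let ?N = "(2 * pi) ^ DIM('a)"
  let ?v = "(multiplier_op a ^^ k) u"
  have Linf: "in_Linf a"
    using a by (simp add: fourier_multipliers_def)
  note v = fourier_L2_multiplier_op_power[OF Linf u(1), of k]
  then have sq: "square_integrable ?v" by blast
  have b1: "in_bfs \<rho> ?v" "bfs_enorm \<rho> ?v \<le> multiplier_enorm \<rho> a ^ k * bfs_enorm \<rho> u"
    using multiplier_op_power_bound[OF _ a(1) u(1,2), of k] bfn_zero_iff[OF \<rho>] by blast+
  have b2: "bfs_enorm (assoc_norm \<rho>) ?v \<le> multiplier_enorm (assoc_norm \<rho>) a ^ k * bfs_enorm (assoc_norm \<rho>) u"
    using multiplier_op_power_bound[OF _ a(2) u(1,3), of k] assoc_norm_AE_zero[of _ \<rho>] by blast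
  have "ennreal ((L2_norm_fun ?v)\<^sup>2) = (\<integral>\<^sup>+x. ennreal (cmod (?v x)) * ennreal (cmod (?v x)) \<partial>lebesgue)"
    unfolding nn_integral_L2[OF sq, symmetric] by (simp add: power2_eq_square ennreal_mult)
  also have "\<dots> \<le> bfs_enorm \<rho> ?v * bfs_enorm (assoc_norm \<rho>) ?v"
    using b1(1) square_integrable_measurable[OF sq] unfolding bfs_enorm_def in_bfs_def
    by (intro assoc_norm_Holder \<rho>) auto
  also have "\<dots> \<le> (multiplier_enorm \<rho> a ^ k * bfs_enorm \<rho> u) *
      (multiplier_enorm (assoc_norm \<rho>) a ^ k * bfs_enorm (assoc_norm \<rho>) u)"
    by (intro mult_mono b1 b2) auto
  finally have Holder: "ennreal ((L2_norm_fun ?v)\<^sup>2) \<le> (multiplier_enorm \<rho> a ^ k * bfs_enorm \<rho> u) *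
      (multiplier_enorm (assoc_norm \<rho>) a ^ k * bfs_enorm (assoc_norm \<rho>) u)" .
  have "(\<integral>\<^sup>+\<xi>. ennreal ((cmod (a \<xi> ^ k * fourier_L2 u \<xi>))\<^sup>2) \<partial>lebesgue)
    = (\<integral>\<^sup>+\<xi>. ennreal ((cmod (fourier_L2 ?v \<xi>))\<^sup>2) \<partial>lebesgue)"
    using v by (intro nn_integral_cong_AE) (auto elim: eventually_mono)
  also have "\<dots> = ennreal ((L2_norm_fun (fourier_L2 ?v))\<^sup>2)"
    by (rule nn_integral_L2[OF square_integrable_fourier_L2[OF sq]])
  also have "\<dots> \<le> ennreal ((sqrt ?N * L2_norm_fun ?v)\<^sup>2)"
    by (intro ennreal_leI power_mono L2_norm_fourier_L2_le sq L2_norm_fun_nonneg)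
  also have "\<dots> = ennreal ?N * ennreal ((L2_norm_fun ?v)\<^sup>2)"
    by (simp add: power_mult_distrib ennreal_mult)
  also have "\<dots> \<le> ennreal ?N * ((multiplier_enorm \<rho> a ^ k * bfs_enorm \<rho> u) *
      (multiplier_enorm (assoc_norm \<rho>) a ^ k * bfs_enorm (assoc_norm \<rho>) u))"
    by (rule mult_left_mono[OF Holder]) simp
  finally show ?thesis
    by (simp only: power_mult_distrib mult_ac)
qed

text \<open>A Chebyshev argument: on the set where |a|^2 > t, the integral of |\<phi>|^2 times t^k
  is at most D K^k. Since K < t, the bound D (K / t)^k tends to 0, so \<phi> vanishes almost
  everywhere on that set.\<close>

lemma AE_multiplier_le_on_support:
  fixes \<phi> a :: "'a \<Rightarrow> complex" and D K t :: real
  assumes meas: "\<phi> \<in> borel_measurable M" "a \<in> borel_measurable M"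
    and KD: "0 \<le> K" "0 \<le> D" "K < t"
    and le: "\<And>k. (\<integral>\<^sup>+\<xi>. ennreal ((cmod (a \<xi> ^ k * \<phi> \<xi>))\<^sup>2) \<partial>M) \<le> ennreal (D * K ^ k)"
  shows "AE \<xi> in M. \<phi> \<xi> = 0 \<or> (cmod (a \<xi>))\<^sup>2 \<le> t"
proof -
  note [measurable] = meas
  have t: "t > 0" using KD by linarith
  let ?h = "\<lambda>\<xi>. ennreal (if t < (cmod (a \<xi>))\<^sup>2 then (cmod (\<phi> \<xi>))\<^sup>2 else 0)"
  let ?J = "\<integral>\<^sup>+\<xi>. ?h \<xi> \<partial>M"
  have J: "?J \<le> ennreal (D * (K / t) ^ k)" for k
  proof -
    have "ennreal (t ^ k) * ?J = (\<integral>\<^sup>+\<xi>. ennreal (t ^ k) * ?h \<xi> \<partial>M)"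
      by (rule nn_integral_cmult[symmetric]) measurable
    also have "\<dots> \<le> (\<integral>\<^sup>+\<xi>. ennreal ((cmod (a \<xi> ^ k * \<phi> \<xi>))\<^sup>2) \<partial>M)"
    proof (rule nn_integral_mono)
      fix \<xi>
      show "ennreal (t ^ k) * ?h \<xi> \<le> ennreal ((cmod (a \<xi> ^ k * \<phi> \<xi>))\<^sup>2)"
      proof (cases "t < (cmod (a \<xi>))\<^sup>2")
        case True
        have "t ^ k * (cmod (\<phi> \<xi>))\<^sup>2 \<le> ((cmod (a \<xi>))\<^sup>2) ^ k * (cmod (\<phi> \<xi>))\<^sup>2"
          using True t by (intro mult_right_mono power_mono) auto
        also have "\<dots> = (cmod (a \<xi> ^ k * \<phi> \<xi>))\<^sup>2"
          by (simp add: norm_mult norm_power power_mult_distrib power_mult[symmetric] mult.commute)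
        finally show ?thesis
          using True t by (simp add: ennreal_mult[symmetric])
      qed simp
    qed
    also have "\<dots> \<le> ennreal (D * K ^ k)"
      by (rule le)
    \<comment> \<open>Division by t^k is carried out by multiplying with the finite positive
      constant 1 / t^k, which cancels also if the integral is infinite.\<close>
    finally have "ennreal (1 / t ^ k) * (ennreal (t ^ k) * ?J) \<le> ennreal (1 / t ^ k) * ennreal (D * K ^ k)"
      by (rule mult_left_mono) simp
    also have "\<dots> = ennreal (D * (K / t) ^ k)"
      using KD t by (simp add: ennreal_mult[symmetric] power_divide)
    also have "ennreal (1 / t ^ k) * (ennreal (t ^ k) * ?J) = ?J"
      using t by (simp add: mult.assoc[symmetric] ennreal_mult[symmetric])
    finally show ?thesis .
  qed
  have "(\<lambda>k. ennreal (D * (K / t) ^ k)) \<longlonglongrightarrow> ennreal (D * 0)"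
    using KD t by (intro tendsto_ennrealI tendsto_mult tendsto_const LIMSEQ_power_zero) simp
  then have "?J \<le> ennreal (D * 0)"
    using J by (intro LIMSEQ_le_const) auto
  then have "?J = 0"
    by simp
  then have "AE \<xi> in M. ?h \<xi> = 0"
    by (subst (asm) nn_integral_0_iff_AE) measurable
  then show ?thesis
    by eventually_elim (auto split: if_splits)
qed

theorem theorem7p10:
  fixes \<rho> :: "('a::euclidean_space \<Rightarrow> ennreal) \<Rightarrow> ennreal"
    and a :: "'a \<Rightarrow> complex"
  assumes "banach_function_norm \<rho>"
    and "a \<in> fourier_multipliers \<rho>"
    and "a \<in> fourier_multipliers (assoc_norm \<rho>)"
  shows "Linf_norm a \<le> sqrt (multiplier_norm \<rho> a) * sqrt (multiplier_norm (assoc_norm \<rho>) a)"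
proof -
  define K where "K = multiplier_norm \<rho> a * multiplier_norm (assoc_norm \<rho>) a"
  have K: "0 \<le> K"
    by (simp add: K_def multiplier_norm_def)
  have M: "multiplier_enorm \<rho> a * multiplier_enorm (assoc_norm \<rho>) a = ennreal K"
    using assms(2,3) by (simp add: K_def multiplier_norm_def fourier_multipliers_def ennreal_mult less_top)
  have am: "a \<in> borel_measurable lebesgue"
    using assms(2) by (simp add: fourier_multipliers_def in_Linf_def)
  \<comment> \<open>A sequence of shrinking cubes, so that only countably many exceptional null sets
    occur; \<open>Suc\<close> keeps the half-side positive at m = 0.\<close>
  define U where "U m = box (- (1 / real (Suc m)) *\<^sub>R One) ((1 / real (Suc m)) *\<^sub>R One :: 'a)" for m
  have supp: "AE \<xi> in lebesgue. fourier_int (indicator (U m)) \<xi> = 0 \<or> (cmod (a \<xi>))\<^sup>2 \<le> t"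
    if t: "K < t" for t m
  proof -
    let ?u = "indicator (U m) :: 'a \<Rightarrow> complex"
    have u: "square_integrable ?u"
      unfolding U_def by (rule square_integrable_indicator_box)
    have e: "(\<lambda>x. ennreal (cmod (?u x))) = indicator (U m)"
      by (auto simp: indicator_def)
    have U: "U m \<in> sets lebesgue" "emeasure lebesgue (U m) < \<infinity>"
      unfolding U_def by (rule box_emeasure_lebesgue_finite)+
    have b: "in_bfs \<rho> ?u" "in_bfs (assoc_norm \<rho>) ?u"
      unfolding in_bfs_def e
      using square_integrable_measurable[OF u] bfn_indicator[OF assms(1) U]
        assoc_norm_indicator_finite[OF assms(1) U] by auto
    define C where "C = enn2real (bfs_enorm \<rho> ?u * bfs_enorm (assoc_norm \<rho>) ?u)"
    have C: "bfs_enorm \<rho> ?u * bfs_enorm (assoc_norm \<rho>) ?u = ennreal C"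
      using b by (simp add: C_def in_bfs_def bfs_enorm_def ennreal_mult_less_top)
    have C0: "0 \<le> C"
      by (simp add: C_def)
    have "AE \<xi> in lebesgue. fourier_L2 ?u \<xi> = 0 \<or> (cmod (a \<xi>))\<^sup>2 \<le> t"
    proof (rule AE_multiplier_le_on_support[OF _ am K _ t])
      show "fourier_L2 ?u \<in> borel_measurable lebesgue"
        by (intro square_integrable_measurable square_integrable_fourier_L2 u)
      show "0 \<le> (2 * pi) ^ DIM('a) * C"
        using C0 by simp
      show "(\<integral>\<^sup>+\<xi>. ennreal ((cmod (a \<xi> ^ k * fourier_L2 ?u \<xi>))\<^sup>2) \<partial>lebesgue)
        \<le> ennreal ((2 * pi) ^ DIM('a) * C * K ^ k)" for k
        using nn_integral_multiplier_power_le[OF assms u b, of k] C0 K unfolding C M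
        by (simp add: ennreal_mult ennreal_power)
    qed
    with fourier_L2_indicator_box[of "- (1 / real (Suc m)) *\<^sub>R One" "(1 / real (Suc m)) *\<^sub>R One :: 'a"]
    show ?thesis
      unfolding U_def by eventually_elim simp
  qed
  have bound: "AE \<xi> in lebesgue. (cmod (a \<xi>))\<^sup>2 \<le> t" if "K < t" for t
  proof -
    \<comment> \<open>Which cube works depends on \<xi>, so the quantifier over m has to come inside
      AE before \<xi> is fixed.\<close>
    have "AE \<xi> in lebesgue. \<forall>m. fourier_int (indicator (U m)) \<xi> = 0 \<or> (cmod (a \<xi>))\<^sup>2 \<le> t"
      unfolding AE_all_countable using supp[OF that] by blast
    then show ?thesis
    proof eventually_elim
      case (elim \<xi>)
      \<comment> \<open>This m makes the half-side 1 / (m + 1) small enough for the phase bound pi /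
        3 in \<open>fourier_int_box_nonzero\<close> at the frequency \<xi>.\<close>
      obtain m :: nat where m: "real DIM('a) * norm \<xi> / (pi / 3) \<le> real m"
        using real_arch_simple by blast
      have "fourier_int (indicator (U m)) \<xi> \<noteq> 0"
        unfolding U_def
      proof (rule fourier_int_box_nonzero)
        have "real DIM('a) * norm \<xi> \<le> real (Suc m) * (pi / 3)"
          using m by (simp add: field_simps) (use pi_gt_zero in linarith)
        then show "real DIM('a) * (1 / real (Suc m)) * norm \<xi> \<le> pi / 3"
          by (simp add: field_simps)
      qed simp
      with elim show ?case by blast
    qed
  qed
  have L: "Linf_norm a \<le> sqrt t" if t: "K < t" for t
  proof -
    have "Linf_enorm a \<le> ereal (sqrt t)"
      unfolding Linf_enorm_def
    proof (rule esssup_I)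
      show "(\<lambda>x. ereal (cmod (a x))) \<in> borel_measurable lebesgue"
        using am by measurable
      show "AE x in lebesgue. ereal (cmod (a x)) \<le> ereal (sqrt t)"
        using bound[OF t] by eventually_elim (simp add: real_le_rsqrt)
    qed
    \<comment> \<open>\<open>real_of_ereal\<close> sends infinite values to 0: the bound excludes
      +\<infinity>, and 0 \<le> sqrt t covers -\<infinity>.\<close>
    then show ?thesis
      using t K unfolding Linf_norm_def by (cases "Linf_enorm a") auto
  qed
  \<comment> \<open>Geometric decay needs t > K strictly, so K is reached as the limit of t = K + 1
    / (n + 1).\<close>
  have "Linf_norm a \<le> sqrt K"
  proof (rule LIMSEQ_le_const)
    show "(\<lambda>n. sqrt (K + inverse (real (Suc n)))) \<longlonglongrightarrow> sqrt K"
      using tendsto_real_sqrt[OF tendsto_add[OF tendsto_const LIMSEQ_inverse_real_of_nat], of K] by simp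
    show "\<exists>N. \<forall>n\<ge>N. Linf_norm a \<le> sqrt (K + inverse (real (Suc n)))"
      by (intro exI[of _ 0] allI impI L) simp
  qed
  then show ?thesis
    by (simp add: K_def real_sqrt_mult)
qed

end
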